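(* Let $\theta=\lambda/\mu$ be an ordinary skew shape (partitions $\mu\subseteq\lambda$) and $n\ge1$. For each column $j$ put $c_j(\theta)=\lambda'_j-\mu'_j$, and put $\kappa_p(\theta)=\#\{j:c_j(\theta)\ge p\}$ for $p\ge1$. If $\max_jc_j(\theta)>n$, then $s_\theta(x_1,\dots,x_n)=0$. Otherwise, pad $\kappa(\theta)=(\kappa_1(\theta),\kappa_2(\theta),\dots)$ by zeros to length $n$. Then $$\operatorname{Supp}(s_\theta)=\mathcal P_{\kappa(\theta)}\cap\mathbb Z^n,\qquad\operatorname{Newt}(s_\theta)=\mathcal P_{\kappa(\theta)}.$$ For $A\subseteq[n]$, the support-polymatroid rank is $$r_\theta(A)=\sum_j\min\{|A|,c_j(\theta)\}=\sum_{p=1}^{|A|}\kappa_p(\theta).$$ Every vertex monomial of $s_\theta(x_1,\dots,x_n)$ has coefficient one, and the support polymatroid is linearly representable over every infinite field.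
   Context: $\lambda'$ is the conjugate partition. $s_\theta=s_\theta(x_1,\dots,x_n)$ is the generating polynomial of semistandard tableaux of shape $\theta$ with entries in $[n]=\{1,\dots,n\}$ (rows weakly increasing, columns strictly increasing). For $F=\sum c_\alpha x^\alpha$, $\operatorname{Supp}(F)=\{\alpha:c_\alpha\ne0\}$, $\operatorname{Newt}(F)=\operatorname{conv}(\operatorname{Supp}(F))$; vertex monomials are $x^\gamma$ with $\gamma$ a vertex of the Newton polytope. $\mathcal P_\kappa=\operatorname{conv}\{\pi\kappa:\pi\in\mathfrak S_n\}\subset\mathbb R^n$, $\mathfrak S_n$ permuting coordinates. The support polymatroid has rank function $r_\theta(A)=\max_{\alpha\in\operatorname{Supp}(s_\theta)}\sum_{i\in A}\alpha_i$; it is linearly representable over a field $k$ if there are subspaces $V_1,\dots,V_n$ of a finite-dimensional $k$-vector space with $\dim_k\sum_{i\in A}V_i=r_\theta(A)$ for all $A\subseteq[n]$. Convention for the empty shape: $\max\varnothing=0$, $\kappa(\varnothing)=(0,\dots,0)\in\mathbb Z^n$, $s_\varnothing=1$. *)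

theory Defs
  imports "HOL-Analysis.Analysis" "HOL-Library.Poly_Mapping" "HOL-Library.FuncSet"
    "HOL-Combinatorics.Permutations"
begin

subsection \<open>Skew shapes\<close>

text \<open>
  Rows, columns and parts are numbered from 0: \<open>f i\<close> is the part usually written
  \<open>f\<^sub>i\<^sub>+\<^sub>1\<close>, and the part \<open>conjugate f j\<close> of the conjugate partition is the length of
  the \<open>(j+1)\<close>-st column.
\<close>

definition is_partition :: "(nat \<Rightarrow> nat) \<Rightarrow> bool" where
  "is_partition f \<longleftrightarrow> antimono f \<and> finite {i. f i \<noteq> 0}"

definition conjugate :: "(nat \<Rightarrow> nat) \<Rightarrow> nat \<Rightarrow> nat" where
  "conjugate f j = card {i. j < f i}"

definition is_skew_shape :: "(nat \<Rightarrow> nat) \<Rightarrow> (nat \<Rightarrow> nat) \<Rightarrow> bool" where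
  "is_skew_shape lam mu \<longleftrightarrow> is_partition lam \<and> is_partition mu \<and> (\<forall>i. mu i \<le> lam i)"

definition cells :: "(nat \<Rightarrow> nat) \<Rightarrow> (nat \<Rightarrow> nat) \<Rightarrow> (nat \<times> nat) set" where
  "cells lam mu = {(i, j). mu i \<le> j \<and> j < lam i}"

definition shape_columns :: "(nat \<Rightarrow> nat) \<Rightarrow> nat set" where
  "shape_columns lam = {..<lam 0}"

definition col_len :: "(nat \<Rightarrow> nat) \<Rightarrow> (nat \<Rightarrow> nat) \<Rightarrow> nat \<Rightarrow> nat" where
  "col_len lam mu j = conjugate lam j - conjugate mu j"

text \<open>The inserted 0 only matters when there are no columns: there the maximum is 0.\<close>

definition max_col_len :: "(nat \<Rightarrow> nat) \<Rightarrow> (nat \<Rightarrow> nat) \<Rightarrow> nat" where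
  "max_col_len lam mu = Max (insert 0 (col_len lam mu ` shape_columns lam))"

definition kappa :: "(nat \<Rightarrow> nat) \<Rightarrow> (nat \<Rightarrow> nat) \<Rightarrow> nat \<Rightarrow> nat" where
  "kappa lam mu p = card {j \<in> shape_columns lam. p \<le> col_len lam mu j}"

subsection \<open>Skew Schur polynomials\<close>

text \<open>
  The alphabet \<open>[n]\<close> is a finite linearly ordered type \<open>'n\<close> with \<open>n = CARD('n)\<close>.  Polynomials
  in the variables indexed by \<open>'n\<close> are finitely supported maps from exponent vectors
  to coefficients, with the convolution product of \<open>HOL-Library.Poly_Mapping\<close>.
  Tableaux are extensional functions on the cells.
\<close>

definition ssyt :: "(nat \<Rightarrow> nat) \<Rightarrow> (nat \<Rightarrow> nat) \<Rightarrow> (nat \<times> nat \<Rightarrow> 'n::linorder) set" where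
  "ssyt lam mu = {T \<in> cells lam mu \<rightarrow>\<^sub>E UNIV.
     (\<forall>i j j'. (i, j) \<in> cells lam mu \<longrightarrow> (i, j') \<in> cells lam mu \<longrightarrow> j < j' \<longrightarrow> T (i, j) \<le> T (i, j')) \<and>
     (\<forall>i i' j. (i, j) \<in> cells lam mu \<longrightarrow> (i', j) \<in> cells lam mu \<longrightarrow> i < i' \<longrightarrow> T (i, j) < T (i', j))}"

definition var :: "'n \<Rightarrow> ('n \<Rightarrow>\<^sub>0 nat) \<Rightarrow>\<^sub>0 int" where
  "var i = Poly_Mapping.single (Poly_Mapping.single i 1) 1"

definition skew_schur ::
    "(nat \<Rightarrow> nat) \<Rightarrow> (nat \<Rightarrow> nat) \<Rightarrow> ('n::{finite,linorder} \<Rightarrow>\<^sub>0 nat) \<Rightarrow>\<^sub>0 int" where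
  "skew_schur lam mu = (\<Sum>T\<in>ssyt lam mu. \<Prod>c\<in>cells lam mu. var (T c))"

subsection \<open>Supports, Newton polytopes, permutohedra\<close>

definition Supp :: "(('n \<Rightarrow>\<^sub>0 nat) \<Rightarrow>\<^sub>0 int) \<Rightarrow> ('n \<Rightarrow>\<^sub>0 nat) set" where
  "Supp F = {\<alpha>. Poly_Mapping.lookup F \<alpha> \<noteq> 0}"

definition exp_vec :: "('n \<Rightarrow>\<^sub>0 nat) \<Rightarrow> real ^ 'n" where
  "exp_vec \<alpha> = (\<chi> i. real (Poly_Mapping.lookup \<alpha> i))"

definition Newt :: "(('n::finite \<Rightarrow>\<^sub>0 nat) \<Rightarrow>\<^sub>0 int) \<Rightarrow> (real ^ 'n) set" where
  "Newt F = convex hull (exp_vec ` Supp F)"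

definition permutohedron :: "real ^ 'n \<Rightarrow> (real ^ 'n::finite) set" where
  "permutohedron v = convex hull {\<chi> i. v $ \<pi> i | \<pi>. \<pi> permutes UNIV}"

definition integer_points :: "(real ^ 'n) set" where
  "integer_points = {x. \<forall>i. x $ i \<in> \<int>}"

text \<open>
  \<open>card {..i}\<close> is the position of \<open>i\<close> in the order of \<open>'n\<close>, running through \<open>1, \<dots>, n\<close>, so
  this is the vector \<open>(\<kappa>\<^sub>1, \<dots>, \<kappa>\<^sub>n)\<close>; entries beyond the longest column are 0.
\<close>

definition kappa_vec :: "(nat \<Rightarrow> nat) \<Rightarrow> (nat \<Rightarrow> nat) \<Rightarrow> real ^ 'n::{finite,linorder}" where
  "kappa_vec lam mu = (\<chi> i. real (kappa lam mu (card {..i})))"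

subsection \<open>The support polymatroid\<close>

definition support_rank :: "(('n::finite \<Rightarrow>\<^sub>0 nat) \<Rightarrow>\<^sub>0 int) \<Rightarrow> 'n set \<Rightarrow> nat" where
  "support_rank F A = Max ((\<lambda>\<alpha>. \<Sum>i\<in>A. Poly_Mapping.lookup \<alpha> i) ` Supp F)"

definition vscale :: "'k::field \<Rightarrow> (nat \<Rightarrow>\<^sub>0 'k) \<Rightarrow> (nat \<Rightarrow>\<^sub>0 'k)" where
  "vscale c v = Poly_Mapping.map ((*) c) v"

lemma lookup_vscale: "Poly_Mapping.lookup (vscale c v) i = c * Poly_Mapping.lookup v i"
  unfolding vscale_def by (simp add: Poly_Mapping.map.rep_eq when_def)

interpretation coord: vector_space "vscale :: 'k::field \<Rightarrow> _"
  by unfold_locales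
    (auto intro!: poly_mapping_eqI simp: lookup_vscale lookup_add algebra_simps)

text \<open>
  The finite-dimensional ambient space is \<open>k\<^sup>m\<close>, realised as the space of those finitely
  supported sequences over \<open>k\<close> whose entries from index \<open>m\<close> on vanish; up to isomorphism these are
  all the finite-dimensional \<open>k\<close>-vector spaces.  The field \<open>k\<close> is given by its type.
\<close>

definition coord_space :: "nat \<Rightarrow> (nat \<Rightarrow>\<^sub>0 'k::field) set" where
  "coord_space m = {v. \<forall>i\<ge>m. Poly_Mapping.lookup v i = 0}"

definition linearly_representable :: "'k::field itself \<Rightarrow> ('n::finite set \<Rightarrow> nat) \<Rightarrow> bool" where
  "linearly_representable _ r \<longleftrightarrow>
     (\<exists>m. \<exists>V :: 'n \<Rightarrow> (nat \<Rightarrow>\<^sub>0 'k) set.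
        (\<forall>i. coord.subspace (V i) \<and> V i \<subseteq> coord_space m) \<and>
        (\<forall>A. coord.dim {\<Sum>i\<in>A. v i | v. \<forall>i\<in>A. v i \<in> V i} = r A))"

end

theory Submission
  imports Defs
begin

text \<open>
  Everything is controlled by the numbers \<open>f(m) = \<kappa>\<^sub>1 + \<dots> + \<kappa>\<^sub>m = \<Sum>\<^sub>j min {m, c\<^sub>j}\<close>.  A column of
  length \<open>c\<^sub>j\<close> has distinct entries, so it holds at most \<open>min {|A|, c\<^sub>j}\<close> entries from a set \<open>A\<close>.
  Summing over the columns, the content of a tableau satisfies \<open>\<alpha>(A) \<le> f(|A|)\<close>, with equality for the
  whole alphabet; such vectors are called \<open>dominated\<close> below, and they are the integer points of the
  base polytope of a polymatroid.

  Conversely, every dominated vector is a content.  Filling each column with \<open>1, 2, \<dots>\<close> from the top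
  gives a tableau of content \<open>\<kappa>\<close>.  The set of contents is closed under smoothing, i.e. under replacing
  two coordinates by two numbers with the same sum that lie between them.  For adjacent letters
  \<open>a < b\<close> this is the mechanism behind the Bender--Knuth involutions: in each row the letters \<open>a\<close> with
  no \<open>b\<close> in their column come after those with one, so the last \<open>a\<close> of a row can be turned into \<open>b\<close>
  when it is unpaired, and dually for \<open>b\<close> (\<open>ssyt_raise_entry\<close>, \<open>ssyt_lower_entry\<close>).  Swaps are
  smoothings, which gives arbitrary pairs of letters.  Finally, a smoothing-closed set that
  contains the rearrangements of \<open>\<kappa>\<close> contains all dominated vectors
  (\<open>dominated_in_smoothing_closed\<close>); this is the integral form of the theorem of Muirhead and of
  Hardy, Littlewood and Polya, and is proved here with tight sets.

  The same closure lemma, applied to the permutohedron, which is convex and symmetric, shows that it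
  contains the dominated vectors, and they are all of its integer points.  This gives the support and the Newton
  polytope.  The rank of \<open>A\<close> is \<open>f(|A|)\<close> because some rearrangement of \<open>\<kappa>\<close> has its largest entries
  on \<open>A\<close>.

  A vertex of the permutohedron is a rearrangement of \<open>\<kappa>\<close>, and the sets of letters that carry
  \<open>\<kappa>\<^sub>1, \<dots>, \<kappa>\<^sub>m\<close> form a full chain on which all the inequalities above are equalities.  Hence each column
  of a tableau with this content consists exactly of the member of the chain of size \<open>c\<^sub>j\<close>, and the
  tableau is unique (\<open>extreme_content_unique\<close>).

  Since \<open>r(A) = \<Sum>\<^sub>j min {|A|, c\<^sub>j}\<close> is a sum of rank functions of uniform matroids, a
  representation is the direct sum over the columns of configurations in general position in \<open>k\<^sup>c\<close> for
  \<open>c = c\<^sub>j\<close>; an infinite field has enough distinct scalars to place them on a moment curve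
  (\<open>sum_of_uniform_representable\<close>).
\<close>

section \<open>Majorization and smoothing\<close>

text \<open>
  The sets of size \<open>m\<close> in the first condition bound the sum of the \<open>m\<close> largest entries of \<open>\<alpha>\<close> by
  \<open>k 1 + \<dots> + k m\<close>, so for antitone \<open>k\<close> this is majorization of \<open>\<alpha>\<close> by \<open>(k 1, \<dots>, k n)\<close>, written
  without sorting.  It also says that \<open>\<alpha>\<close> is a base of the polymatroid with rank function \<open>A \<mapsto> k 1 + \<dots> + k |A|\<close>.
\<close>

definition dominated :: "(nat \<Rightarrow> nat) \<Rightarrow> ('n::finite \<Rightarrow> nat) \<Rightarrow> bool" where
  "dominated k \<alpha> \<longleftrightarrow>
     (\<forall>A. sum \<alpha> A \<le> sum k {1..card A}) \<and> sum \<alpha> UNIV = sum k {1..CARD('n)}"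

text \<open>
  The lower bounds on \<open>x\<close> and \<open>y\<close> force both into the interval spanned by \<open>\<alpha> i\<close> and \<open>\<alpha> j\<close>; its
  endpoints are allowed, so swapping two coordinates is a smoothing.
\<close>

definition smoothing_closed :: "('n \<Rightarrow> nat) set \<Rightarrow> bool" where
  "smoothing_closed C \<longleftrightarrow>
     (\<forall>\<alpha>\<in>C. \<forall>i j x y. i \<noteq> j \<longrightarrow> x + y = \<alpha> i + \<alpha> j \<longrightarrow> min (\<alpha> i) (\<alpha> j) \<le> x \<longrightarrow>
        min (\<alpha> i) (\<alpha> j) \<le> y \<longrightarrow> \<alpha>(i := x, j := y) \<in> C)"

lemma smoothing_closed_permute:
  assumes C: "smoothing_closed C" and "\<alpha> \<in> C" and p: "p permutes (UNIV :: 'n::finite set)"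
  shows "\<alpha> \<circ> p \<in> C"
proof -
  have swap_in_C: "\<beta> \<circ> Transposition.transpose a b \<in> C" if "\<beta> \<in> C" "a \<noteq> b" for \<beta> a b
  proof -
    have "\<beta>(a := \<beta> b, b := \<beta> a) \<in> C"
      using C that unfolding smoothing_closed_def by (auto simp: add.commute)
    also have "\<beta>(a := \<beta> b, b := \<beta> a) = \<beta> \<circ> Transposition.transpose a b"
      by (auto simp: fun_eq_iff Transposition.transpose_def)
    finally show ?thesis .
  qed
  from p finite[of UNIV] have "\<forall>\<beta>\<in>C. \<beta> \<circ> p \<in> C"
  proof (induction rule: permutes_induct)
    case id
    then show ?case by simp
  next
    case (swap a b p)
    show ?case
    proof
      fix \<beta> assume "\<beta> \<in> C"
      then have "\<beta> \<circ> Transposition.transpose a b \<circ> p \<in> C"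
        using swap_in_C swap.IH \<open>a \<noteq> b\<close> by blast
      then show "\<beta> \<circ> (Transposition.transpose a b \<circ> p) \<in> C"
        by (simp only: o_assoc)
    qed
  qed
  with \<open>\<alpha> \<in> C\<close> show ?thesis by blast
qed

lemma smoothing_closed_rearrange:
  fixes e e' :: "'n::finite \<Rightarrow> nat"
  assumes C: "smoothing_closed C" and "k \<circ> e' \<in> C"
    and e': "bij_betw e' UNIV {1..CARD('n)}" and e: "bij_betw e UNIV {1..CARD('n)}"
  shows "k \<circ> e \<in> C"
proof -
  define p where "p = inv_into UNIV e' \<circ> e"
  have "bij_betw p UNIV UNIV"
    unfolding p_def using e bij_betw_inv_into[OF e'] by (rule bij_betw_trans)
  then have "p permutes UNIV"
    by (rule bij_imp_permutes) simp
  then have "k \<circ> e' \<circ> p \<in> C"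
    using smoothing_closed_permute assms(1,2) by blast
  also have "e i \<in> e' ` UNIV" for i
    using e e' by (auto simp: bij_betw_def)
  then have "k \<circ> e' \<circ> p = k \<circ> e"
    by (auto simp: fun_eq_iff p_def f_inv_into_f)
  finally show ?thesis .
qed

lemma partial_sum_concave:
  fixes k :: "nat \<Rightarrow> nat"
  assumes "antimono k"
  shows "sum k {1..x + u + v} + sum k {1..x} \<le> sum k {1..x + u} + sum k {1..x + v}"
proof (induction v)
  case (Suc v)
  have "k (Suc (x + u + v)) \<le> k (Suc (x + v))"
    using assms by (auto simp: antimono_def)
  with Suc show ?case by (simp add: algebra_simps)
qed simp

text \<open>
  Call \<open>A\<close> tight if the dominance inequality for \<open>A\<close> is an equality.  By concavity of the partial
  sums of \<open>k\<close> the bound is submodular while \<open>A \<mapsto> \<alpha>(A)\<close> is modular, so the two slacks for the union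
  and the intersection of tight sets add up to at most zero.
\<close>

lemma tight_Un_Int:
  fixes \<alpha> :: "'n::finite \<Rightarrow> nat"
  assumes k: "antimono k" and \<alpha>: "\<And>A. sum \<alpha> A \<le> sum k {1..card A}"
    and A: "sum \<alpha> A = sum k {1..card A}" and B: "sum \<alpha> B = sum k {1..card B}"
  shows "sum \<alpha> (A \<union> B) = sum k {1..card (A \<union> B)}"
    and "sum \<alpha> (A \<inter> B) = sum k {1..card (A \<inter> B)}"
proof -
  have cA: "card (A \<inter> B) + card (A - B) = card A" and cB: "card (A \<inter> B) + card (B - A) = card B"
    by (metis card_Int_Diff finite, metis card_Int_Diff finite Int_commute)
  have "card (A \<union> B) = card (A \<inter> B) + card (A - B) + card (B - A)"
    using card_Un_Int[of A B] cA cB by simp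
  then have "sum k {1..card (A \<union> B)} + sum k {1..card (A \<inter> B)}
      \<le> sum k {1..card A} + sum k {1..card B}"
    using partial_sum_concave[OF k, of "card (A \<inter> B)" "card (A - B)" "card (B - A)"] cA cB
    by simp
  also have "\<dots> = sum \<alpha> (A \<union> B) + sum \<alpha> (A \<inter> B)"
    using A B sum.union_inter[of A B \<alpha>] by simp
  finally have "sum k {1..card (A \<union> B)} + sum k {1..card (A \<inter> B)}
      \<le> sum \<alpha> (A \<union> B) + sum \<alpha> (A \<inter> B)" .
  with \<alpha>[of "A \<union> B"] \<alpha>[of "A \<inter> B"]
  show "sum \<alpha> (A \<union> B) = sum k {1..card (A \<union> B)}"
    and "sum \<alpha> (A \<inter> B) = sum k {1..card (A \<inter> B)}"
    by linarith+
qed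

text \<open>
  Under this separation hypothesis there is a full chain of tight sets: add to a tight set \<open>A\<close> a
  remaining \<open>i\<close> with \<open>\<alpha> i\<close> as large as possible; for each other remaining \<open>j\<close>, joining a separating set to \<open>A\<close>
  gives a tight set that contains \<open>A\<close> and \<open>i\<close> but not \<open>j\<close>, and the intersection of all of
  these is \<open>insert i A\<close>.  Along the chain the sums are the partial sums of \<open>k\<close>, hence the values of
  \<open>\<alpha>\<close> are those of \<open>k\<close>.
\<close>

lemma dominated_separated_is_rearrangement:
  fixes \<alpha> :: "'n::finite \<Rightarrow> nat"
  assumes k: "antimono k" and \<alpha>: "dominated k \<alpha>"
    and sep: "\<And>i j. i \<noteq> j \<Longrightarrow> \<alpha> j \<le> \<alpha> i \<Longrightarrow>
                 \<exists>A. i \<in> A \<and> j \<notin> A \<and> sum \<alpha> A = sum k {1..card A}"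
  shows "\<exists>e. bij_betw e UNIV {1..CARD('n)} \<and> \<alpha> = k \<circ> e"
proof -
  have le: "sum \<alpha> A \<le> sum k {1..card A}" for A
    using \<alpha> by (simp add: dominated_def)
  have "\<exists>A e. sum \<alpha> A = sum k {1..card A} \<and> bij_betw e A {1..m} \<and> (\<forall>i\<in>A. \<alpha> i = k (e i))"
    if "m \<le> CARD('n)" for m
    using that
  proof (induction m)
    case 0
    show ?case by (intro exI[of _ "{}"]) (auto simp: bij_betw_def)
  next
    case (Suc m)
    then obtain A e where A: "sum \<alpha> A = sum k {1..card A}" and e: "bij_betw e A {1..m}"
      and \<alpha>e: "\<forall>i\<in>A. \<alpha> i = k (e i)" by auto
    have cA: "card A = m"
      using bij_betw_same_card[OF e] by simp
    have "A \<noteq> UNIV"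
      using cA Suc.prems by auto
    then have "- A \<noteq> {}"
      by auto
    then have "Max (\<alpha> ` (- A)) \<in> \<alpha> ` (- A)"
      by (intro Max_in) auto
    then obtain i where i: "i \<notin> A" and "\<alpha> i = Max (\<alpha> ` (- A))"
      by auto
    then have imax: "\<alpha> j \<le> \<alpha> i" if "j \<notin> A" for j
      using that by (auto intro: Max_ge)
    \<comment> \<open>Exclude the elements of \<open>J\<close> one at a time.\<close>
    have "\<exists>D. insert i A \<subseteq> D \<and> D \<inter> J = {} \<and> sum \<alpha> D = sum k {1..card D}"
      if "J \<subseteq> - insert i A" for J
      using finite[of J] that
    proof (induction J rule: finite_induct)
      case empty
      show ?case using \<alpha> by (intro exI[of _ UNIV]) (simp add: dominated_def)
    next
      case (insert j J)
      then obtain D where D: "insert i A \<subseteq> D" "D \<inter> J = {}" "sum \<alpha> D = sum k {1..card D}"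
        by auto
      from insert have "j \<noteq> i" "j \<notin> A" by auto
      then obtain B where B: "i \<in> B" "j \<notin> B" "sum \<alpha> B = sum k {1..card B}"
        using sep[OF \<open>j \<noteq> i\<close>[symmetric] imax[OF \<open>j \<notin> A\<close>]] by blast
      have AB: "sum \<alpha> (A \<union> B) = sum k {1..card (A \<union> B)}"
        using tight_Un_Int(1)[OF k le A B(3)] .
      show ?case
        using tight_Un_Int(2)[OF k le AB D(3)] B D \<open>j \<notin> A\<close>
        by (intro exI[of _ "(A \<union> B) \<inter> D"]) auto
    qed
    from this[of "- insert i A"] obtain D where D: "insert i A \<subseteq> D" "D \<inter> - insert i A = {}"
        "sum \<alpha> D = sum k {1..card D}"
      by auto
    then have "D = insert i A" by auto
    with D have t: "sum \<alpha> (insert i A) = sum k {1..card (insert i A)}"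
      by simp
    then have "\<alpha> i = k (Suc m)"
      using i A cA by simp
    moreover have "bij_betw (e(i := Suc m)) (insert i A) {1..Suc m}"
    proof -
      have "bij_betw (e(i := Suc m)) A {1..m}"
        using e i by (subst bij_betw_cong[of _ _ e]) auto
      then have "bij_betw (e(i := Suc m)) (A \<union> {i}) ({1..m} \<union> {(e(i := Suc m)) i})"
        by (intro notIn_Un_bij_betw) (use i in auto)
      also have "{1..m} \<union> {(e(i := Suc m)) i} = {1..Suc m}" by auto
      finally show ?thesis by (simp only: Un_insert_right Un_empty_right)
    qed
    moreover have "\<forall>x\<in>insert i A. \<alpha> x = k ((e(i := Suc m)) x)"
      using \<alpha>e \<open>\<alpha> i = k (Suc m)\<close> by auto
    ultimately show ?case using t by blast
  qed
  from this[of "CARD('n)"] obtain A e where e: "bij_betw e A {1..CARD('n)}"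
    and \<alpha>e: "\<forall>i\<in>A. \<alpha> i = k (e i)" by auto
  have "A = UNIV"
    using bij_betw_same_card[OF e] by (metis card_subset_eq finite subset_UNIV card_atLeastAtMost diff_Suc_1)
  with e \<alpha>e show ?thesis by (auto simp: fun_eq_iff)
qed

text \<open>
  Undo smoothings, starting from \<open>\<alpha>\<close>.  If no tight set separates \<open>i\<close> from \<open>j\<close> and \<open>\<alpha> j \<le> \<alpha> i\<close>,
  moving one unit from \<open>j\<close> to \<open>i\<close> preserves dominance, and \<open>\<alpha>\<close> is a smoothing of the result.
  Each such move increases the sum of squares, which is at most the square of the fixed total;
  the process therefore ends, and it ends in a rearrangement of \<open>k\<close> by the previous lemma.
\<close>

lemma dominated_in_smoothing_closed:
  fixes \<alpha> :: "'n::finite \<Rightarrow> nat"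
  assumes k: "antimono k" and C: "smoothing_closed C"
    and base: "\<And>e. bij_betw e UNIV {1..CARD('n)} \<Longrightarrow> k \<circ> e \<in> C"
    and "dominated k \<alpha>"
  shows "\<alpha> \<in> C"
  using \<open>dominated k \<alpha>\<close>
proof (induction "(sum k {1..CARD('n)})\<^sup>2 - (\<Sum>i\<in>UNIV. (\<alpha> i)\<^sup>2)" arbitrary: \<alpha> rule: less_induct)
  case less
  then have le: "sum \<alpha> A \<le> sum k {1..card A}" and tot: "sum \<alpha> UNIV = sum k {1..CARD('n)}" for A
    by (auto simp: dominated_def)
  show ?case
  proof (cases "\<forall>i j. i \<noteq> j \<longrightarrow> \<alpha> j \<le> \<alpha> i \<longrightarrow> (\<exists>A. i \<in> A \<and> j \<notin> A \<and> sum \<alpha> A = sum k {1..card A})")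
    case True
    then have "\<exists>e. bij_betw e UNIV {1..CARD('n)} \<and> \<alpha> = k \<circ> e"
      using dominated_separated_is_rearrangement[OF k less.prems] by blast
    then show ?thesis using base by blast
  next
    case False
    then obtain i j where ij: "i \<noteq> j" "\<alpha> j \<le> \<alpha> i"
      and slack: "\<And>A. i \<in> A \<Longrightarrow> j \<notin> A \<Longrightarrow> sum \<alpha> A \<noteq> sum k {1..card A}" by auto
    \<comment> \<open>Otherwise the complement of \<open>j\<close> would be tight and separate \<open>i\<close> from \<open>j\<close>.\<close>
    have pos: "\<alpha> j > 0"
    proof (rule ccontr)
      assume "\<not> \<alpha> j > 0"
      then have "sum \<alpha> (UNIV - {j}) = sum k {1..CARD('n)}"
        using tot by (simp add: sum.remove[of UNIV j \<alpha>])
      moreover have "sum k {1..card (UNIV - {j})} \<le> sum k {1..CARD('n)}"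
        by (intro sum_mono2) auto
      ultimately have "sum \<alpha> (UNIV - {j}) = sum k {1..card (UNIV - {j})}"
        using le[of "UNIV - {j}"] by simp
      with slack[of "UNIV - {j}"] ij show False by simp
    qed
    define \<beta> where "\<beta> = \<alpha>(i := \<alpha> i + 1, j := \<alpha> j - 1)"
    \<comment> \<open>Sums over \<open>A\<close> are compared by splitting off the two coordinates that change.\<close>
    have split: "sum g A = sum g (A - {i, j}) + (if i \<in> A then g i else 0) + (if j \<in> A then g j else 0)"
      for g :: "'n \<Rightarrow> nat" and A
    proof -
      have "sum g A = sum g (A \<inter> {i, j}) + sum g (A - {i, j})"
        by (intro sum.Int_Diff) simp
      moreover have "sum g (A \<inter> {i, j}) = (if i \<in> A then g i else 0) + (if j \<in> A then g j else 0)"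
        using ij(1) by (cases "i \<in> A"; cases "j \<in> A") (simp_all add: Int_insert_right)
      ultimately show ?thesis by simp
    qed
    have rest: "sum (\<lambda>x. h (\<beta> x)) (A - {i, j}) = sum (\<lambda>x. h (\<alpha> x)) (A - {i, j})" for h :: "nat \<Rightarrow> nat" and A
      by (intro sum.cong) (auto simp: \<beta>_def)
    have \<beta>ij: "\<beta> i = \<alpha> i + 1" "\<beta> j = \<alpha> j - 1"
      using ij by (auto simp: \<beta>_def)
    have sum\<beta>: "sum \<beta> A + (if j \<in> A then 1 else 0) = sum \<alpha> A + (if i \<in> A then 1 else 0)" for A
      using split[of \<beta> A] split[of \<alpha> A] rest[of "\<lambda>x. x" A] \<beta>ij pos by auto
    have dom: "dominated k \<beta>"
    proof -
      have "sum \<beta> A \<le> sum k {1..card A}" for A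
        using sum\<beta>[of A] le[of A] slack[of A] by (auto split: if_splits)
      moreover have "sum \<beta> UNIV = sum k {1..CARD('n)}"
        using sum\<beta>[of UNIV] tot by simp
      ultimately show ?thesis by (simp add: dominated_def)
    qed
    have "(\<Sum>x\<in>UNIV. (\<beta> x)\<^sup>2) > (\<Sum>x\<in>UNIV. (\<alpha> x)\<^sup>2)"
    proof -
      obtain c where c: "\<alpha> j = Suc c" using pos by (cases "\<alpha> j") auto
      have "(\<alpha> i + 1)\<^sup>2 + c\<^sup>2 > (\<alpha> i)\<^sup>2 + (Suc c)\<^sup>2"
        using ij c by (simp add: power2_eq_square algebra_simps)
      then show ?thesis
        using split[of "\<lambda>x. (\<beta> x)\<^sup>2" UNIV] split[of "\<lambda>x. (\<alpha> x)\<^sup>2" UNIV] rest[of "\<lambda>x. x\<^sup>2" UNIV] \<beta>ij c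
        by simp
    qed
    moreover have "(\<Sum>x\<in>UNIV. (\<beta> x)\<^sup>2) \<le> (sum k {1..CARD('n)})\<^sup>2"
    proof -
      have "(\<Sum>x\<in>UNIV. (\<beta> x)\<^sup>2) \<le> (\<Sum>x\<in>UNIV. \<beta> x * sum \<beta> UNIV)"
        by (intro sum_mono) (auto simp: power2_eq_square member_le_sum)
      also have "\<dots> = (sum \<beta> UNIV)\<^sup>2"
        by (simp add: sum_distrib_right power2_eq_square)
      finally show ?thesis using dom by (simp add: dominated_def)
    qed
    ultimately have "\<beta> \<in> C"
      using less.hyps[OF _ dom] by simp
    moreover have "\<alpha> = \<beta>(i := \<alpha> i, j := \<alpha> j)"
      by (auto simp: \<beta>_def)
    moreover have "\<alpha> i + \<alpha> j = \<beta> i + \<beta> j" "min (\<beta> i) (\<beta> j) \<le> \<alpha> i" "min (\<beta> i) (\<beta> j) \<le> \<alpha> j"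
      using \<beta>ij pos ij by auto
    ultimately show ?thesis
      using C ij(1) unfolding smoothing_closed_def by metis
  qed
qed

text \<open>
  A smoothing of \<open>i < j\<close> is conjugated by swaps: swap \<open>i\<close> with its successor \<open>k\<close>, smooth the closer
  pair \<open>k < j\<close>, and swap back.
\<close>

lemma smoothing_closed_if_adjacent:
  fixes C :: "('n::{finite,linorder} \<Rightarrow> nat) set"
  assumes adj: "\<And>\<alpha> i j x y. \<alpha> \<in> C \<Longrightarrow> i < j \<Longrightarrow> {i<..<j} = {} \<Longrightarrow> x + y = \<alpha> i + \<alpha> j \<Longrightarrow>
      min (\<alpha> i) (\<alpha> j) \<le> x \<Longrightarrow> min (\<alpha> i) (\<alpha> j) \<le> y \<Longrightarrow> \<alpha>(i := x, j := y) \<in> C"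
  shows "smoothing_closed C"
proof -
  have *: "\<alpha>(i := x, j := y) \<in> C"
    if "\<alpha> \<in> C" "i < j" "x + y = \<alpha> i + \<alpha> j" "min (\<alpha> i) (\<alpha> j) \<le> x" "min (\<alpha> i) (\<alpha> j) \<le> y"
    for \<alpha> i j x y
    using that
  proof (induction "card {i<..<j}" arbitrary: \<alpha> i rule: less_induct)
    case less
    show ?case
    proof (cases "{i<..<j} = {}")
      case True
      then show ?thesis using adj less.prems by blast
    next
      case False
      define k where "k = Min {i<..<j}"
      have "k \<in> {i<..<j}"
        unfolding k_def using False by (intro Min_in) auto
      then have k: "i < k" "k < j" by auto
      have "l \<notin> {i<..<k}" for l
      proof
        assume l: "l \<in> {i<..<k}"
        then have "l \<in> {i<..<j}" using k by auto
        then have "k \<le> l"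
          unfolding k_def by (intro Min_le) simp_all
        with l show False by auto
      qed
      then have ik: "{i<..<k} = {}" by blast
      have "{k<..<j} \<subset> {i<..<j}"
        using k by auto
      then have smaller: "card {k<..<j} < card {i<..<j}"
        by (simp add: psubset_card_mono)
      have 1: "\<alpha>(i := \<alpha> k, k := \<alpha> i) \<in> C"
        using adj[OF less.prems(1) k(1) ik] by simp
      have 2: "\<alpha>(i := \<alpha> k, k := \<alpha> i, k := x, j := y) \<in> C"
        by (rule less.hyps[OF smaller 1 k(2)]) (use less.prems(3-5) k in auto)
      have "\<alpha>(i := \<alpha> k, k := \<alpha> i, k := x, j := y, i := x, k := \<alpha> k) \<in> C"
        by (rule adj[OF 2 k(1) ik]) (use k in auto)
      also have "\<alpha>(i := \<alpha> k, k := \<alpha> i, k := x, j := y, i := x, k := \<alpha> k) = \<alpha>(i := x, j := y)"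
        using k by (auto simp: fun_eq_iff)
      finally show ?thesis .
    qed
  qed
  show ?thesis
    unfolding smoothing_closed_def
  proof (intro ballI allI impI)
    fix \<alpha> i j x y
    assume "\<alpha> \<in> C" "i \<noteq> j" "x + y = \<alpha> i + \<alpha> j" "min (\<alpha> i) (\<alpha> j) \<le> x" "min (\<alpha> i) (\<alpha> j) \<le> y"
    then show "\<alpha>(i := x, j := y) \<in> C"
      using *[of \<alpha> i j x y] *[of \<alpha> j i y x]
      by (cases "i < j") (auto simp: fun_upd_twist add.commute min.commute)
  qed
qed

text \<open>The largest element of \<open>B\<close> is at least \<open>card B\<close>, so removing it allows induction.\<close>

lemma sum_le_initial_sum:
  fixes k :: "nat \<Rightarrow> nat"
  assumes k: "antimono k" and "finite B" "B \<subseteq> {1..}"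
  shows "sum k B \<le> sum k {1..card B}"
  using assms(2,3)
proof (induction B rule: finite_linorder_max_induct)
  case (insert b B)
  have "B \<subseteq> {1..<b}"
    using insert by auto
  then have "card B \<le> b - 1"
    using card_mono[of "{1..<b}" B] by simp
  then have "Suc (card B) \<le> b"
    using insert.prems by auto
  then have "k b \<le> k (Suc (card B))"
    using k by (auto simp: antimono_def)
  moreover have "b \<notin> B" using insert.hyps by auto
  ultimately show ?case using insert by simp
qed simp

lemma dominated_rearrangement:
  assumes k: "antimono k" and e: "bij_betw e (UNIV :: 'n::finite set) {1..CARD('n)}"
  shows "dominated k (k \<circ> e)"
  unfolding dominated_def
proof (intro conjI allI)
  fix A :: "'n set"
  have inj: "inj_on e A" and img: "e ` A \<subseteq> {1..}"
    using e by (auto simp: bij_betw_def inj_on_def)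
  have "sum (k \<circ> e) A = sum k (e ` A)"
    using sum.reindex[OF inj, of k] by simp
  also have "\<dots> \<le> sum k {1..card (e ` A)}"
    using img by (intro sum_le_initial_sum[OF k]) auto
  finally show "sum (k \<circ> e) A \<le> sum k {1..card A}"
    by (simp add: card_image[OF inj])
  show "sum (k \<circ> e) UNIV = sum k {1..CARD('n)}"
    using sum.reindex_bij_betw[OF e, of k] by simp
qed

lemma rearrangement_initial_on:
  fixes A :: "'n::finite set"
  obtains e where "bij_betw e (UNIV :: 'n set) {1..CARD('n)}" "bij_betw e A {1..card A}"
proof -
  have "card A + card (- A) = CARD('n)"
    using card_Un_disjoint[of A "- A"] by simp
  then have "card {Suc (card A)..CARD('n)} = card (- A)"
    by simp
  then obtain g where g: "bij_betw g (- A) {Suc (card A)..CARD('n)}"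
    using finite_same_card_bij[of "- A" "{Suc (card A)..CARD('n)}"] by auto
  obtain f where f: "bij_betw f A {1..card A}"
    using finite_same_card_bij[of A "{1..card A}"] by auto
  let ?e = "\<lambda>i. if i \<in> A then f i else g i"
  have eA: "bij_betw ?e A {1..card A}"
    using f by (rule bij_betw_cong[THEN iffD1, rotated]) simp
  moreover have "bij_betw ?e (- A) {Suc (card A)..CARD('n)}"
    using g by (rule bij_betw_cong[THEN iffD1, rotated]) simp
  ultimately have "bij_betw ?e (A \<union> - A) ({1..card A} \<union> {Suc (card A)..CARD('n)})"
    by (rule bij_betw_combine) auto
  moreover have "{1..card A} \<union> {Suc (card A)..CARD('n)} = {1..CARD('n)}"
    using card_mono[of "UNIV :: 'n set" A] by auto
  ultimately show ?thesis using that eA by simp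
qed

section \<open>Positions in a finite linear order\<close>

lemma card_atMost_less_iff: "card {..i} < card {..j} \<longleftrightarrow> i < (j :: 'n::{finite,linorder})"
proof
  assume "i < j"
  then have "{..i} \<subset> {..j}" by auto
  then show "card {..i} < card {..j}" by (simp add: psubset_card_mono)
next
  assume less: "card {..i} < card {..j}"
  show "i < j"
  proof (rule ccontr)
    assume "\<not> i < j"
    then have "card {..j} \<le> card {..i}" by (intro card_mono) auto
    with less show False by simp
  qed
qed

lemma bij_betw_card_atMost:
  "bij_betw (\<lambda>i::'n::{finite,linorder}. card {..i}) UNIV {1..CARD('n)}"
proof -
  have inj: "inj (\<lambda>i::'n. card {..i})"
    by (rule injI) (metis card_atMost_less_iff less_irrefl linorder_neqE)
  have "card {..i} \<in> {1..CARD('n)}" for i :: 'n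
  proof -
    have "i \<in> {..i}" by simp
    then have "card {..i} > 0" by (auto simp: card_gt_0_iff)
    moreover have "card {..i} \<le> CARD('n)" by (intro card_mono) auto
    ultimately show ?thesis by auto
  qed
  then have "(\<lambda>i::'n. card {..i}) ` UNIV = {1..CARD('n)}"
    by (intro card_subset_eq) (auto simp: card_image[OF inj])
  with inj show ?thesis by (simp add: bij_betw_def)
qed

section \<open>The integer points of a permutohedron\<close>

definition real_vec :: "('n \<Rightarrow> nat) \<Rightarrow> real ^ 'n" where
  "real_vec \<alpha> = (\<chi> i. real (\<alpha> i))"

lemma real_vec_nth [simp]: "real_vec \<alpha> $ i = real (\<alpha> i)"
  by (simp add: real_vec_def)

lemma permutohedron_eq_hull_rearrangements:
  "permutohedron (real_vec (\<lambda>i. k (card {..i})) :: real ^ 'n::{finite,linorder}) =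
     convex hull {real_vec (k \<circ> e) | e. bij_betw e (UNIV :: 'n set) {1..CARD('n)}}"
proof -
  let ?pos = "\<lambda>i::'n. card {..i}"
  note pos = bij_betw_card_atMost[where 'n='n]
  have "{\<chi> i. real_vec (\<lambda>i. k (card {..i})) $ p i | p. p permutes (UNIV :: 'n set)} =
      {real_vec (k \<circ> e) | e. bij_betw e (UNIV :: 'n set) {1..CARD('n)}}" (is "?L = ?R")
  proof
    show "?L \<subseteq> ?R"
    proof
      fix x assume "x \<in> ?L"
      then obtain p where p: "p permutes (UNIV :: 'n set)" and x: "x = real_vec (k \<circ> (?pos \<circ> p))"
        by (auto simp: vec_eq_iff)
      have "bij_betw (?pos \<circ> p) UNIV {1..CARD('n)}"
        using permutes_imp_bij[OF p] pos by (rule bij_betw_trans)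
      with x show "x \<in> ?R" by blast
    qed
    show "?R \<subseteq> ?L"
    proof
      fix x assume "x \<in> ?R"
      then obtain e where e: "bij_betw e (UNIV :: 'n set) {1..CARD('n)}" and x: "x = real_vec (k \<circ> e)"
        by blast
      define p where "p = inv_into UNIV ?pos \<circ> e"
      have "bij_betw p UNIV UNIV"
        unfolding p_def using e bij_betw_inv_into[OF pos] by (rule bij_betw_trans)
      then have "p permutes UNIV"
        by (rule bij_imp_permutes) simp
      moreover have "?pos (p i) = e i" for i
        unfolding p_def comp_def using bij_betwE[OF e] bij_betw_imp_surj_on[OF pos]
        by (intro f_inv_into_f[where f = ?pos]) blast
      then have "x = (\<chi> i. real_vec (\<lambda>i. k (card {..i})) $ p i)"
        by (simp add: x vec_eq_iff)
      ultimately show "x \<in> ?L" by blast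
    qed
  qed
  then show ?thesis by (simp add: permutohedron_def)
qed

text \<open>
  A smoothing of \<open>\<alpha>\<close> is a convex combination of \<open>\<alpha>\<close> and of the vector with the two coordinates swapped.
\<close>

lemma smoothing_closed_convex:
  fixes P :: "(real ^ 'n::finite) set"
  assumes P: "convex P"
    and swap: "\<And>x i j. x \<in> P \<Longrightarrow> (\<chi> l. x $ Transposition.transpose i j l) \<in> P"
  shows "smoothing_closed {\<alpha>. real_vec \<alpha> \<in> P}"
  unfolding smoothing_closed_def
proof (intro ballI allI impI)
  fix \<alpha> i j x y
  assume "\<alpha> \<in> {\<alpha>. real_vec \<alpha> \<in> P}" "i \<noteq> j" and xy: "x + y = \<alpha> i + \<alpha> j"
    "min (\<alpha> i) (\<alpha> j) \<le> x" "min (\<alpha> i) (\<alpha> j) \<le> y"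
  then have \<alpha>: "real_vec \<alpha> \<in> P" by simp
  show "\<alpha>(i := x, j := y) \<in> {\<alpha>. real_vec \<alpha> \<in> P}"
  proof (cases "\<alpha> i = \<alpha> j")
    case True
    then have "x = \<alpha> i" "y = \<alpha> j" using xy by auto
    with \<alpha> show ?thesis by simp
  next
    case False
    let ?a = "real (\<alpha> i)" and ?b = "real (\<alpha> j)"
    \<comment> \<open>The weight for which the combination has \<open>i\<close>-th coordinate \<open>x\<close>.\<close>
    define t where "t = (real x - ?b) / (?a - ?b)"
    have ab: "?a - ?b \<noteq> 0" using False by simp
    have t: "0 \<le> t" "0 \<le> 1 - t"
    proof -
      have "1 - t = (?a - real x) / (?a - ?b)"
        using ab by (simp add: t_def field_simps)
      moreover have "?a > ?b \<and> ?b \<le> real x \<and> real x \<le> ?a \<or> ?a < ?b \<and> ?a \<le> real x \<and> real x \<le> ?b"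
        using xy False by auto
      ultimately show "0 \<le> t" "0 \<le> 1 - t"
        unfolding t_def by (auto intro: divide_nonneg_nonneg divide_nonpos_nonpos)
    qed
    have x: "t * ?a + (1 - t) * ?b = real x"
    proof -
      have "t * ?a + (1 - t) * ?b = ?b + t * (?a - ?b)" by (simp add: algebra_simps)
      also have "\<dots> = real x" using ab by (simp add: t_def)
      finally show ?thesis .
    qed
    have y: "t * ?b + (1 - t) * ?a = real y"
    proof -
      have "t * ?b + (1 - t) * ?a = ?a + ?b - (t * ?a + (1 - t) * ?b)" by (simp add: algebra_simps)
      also have "\<dots> = real y" unfolding x using xy(1) by linarith
      finally show ?thesis .
    qed
    have "t *\<^sub>R real_vec \<alpha> + (1 - t) *\<^sub>R (\<chi> l. real_vec \<alpha> $ Transposition.transpose i j l) \<in> P"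
      using P \<alpha> swap[OF \<alpha>] t by (intro convexD) auto
    also have "t *\<^sub>R real_vec \<alpha> + (1 - t) *\<^sub>R (\<chi> l. real_vec \<alpha> $ Transposition.transpose i j l) =
        real_vec (\<alpha>(i := x, j := y))"
      unfolding vec_eq_iff
    proof
      fix l
      consider "l = i" | "l = j" | "l \<noteq> i" "l \<noteq> j" by blast
      then show "(t *\<^sub>R real_vec \<alpha> + (1 - t) *\<^sub>R (\<chi> l. real_vec \<alpha> $ Transposition.transpose i j l)) $ l =
          real_vec (\<alpha>(i := x, j := y)) $ l"
      proof cases
        case 1
        then show ?thesis using x \<open>i \<noteq> j\<close> by simp
      next
        case 2
        then show ?thesis using y by simp
      next
        case 3
        then show ?thesis by (simp add: algebra_simps)
      qed
    qed
    finally show ?thesis by simp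
  qed
qed

lemma hull_rearrangements_swap:
  fixes k :: "nat \<Rightarrow> nat"
  assumes "x \<in> convex hull {real_vec (k \<circ> e) | e. bij_betw e (UNIV :: 'n::finite set) {1..CARD('n)}}"
  shows "(\<chi> l. x $ Transposition.transpose i j l) \<in>
    convex hull {real_vec (k \<circ> e) | e. bij_betw e (UNIV :: 'n set) {1..CARD('n)}}"
proof -
  let ?S = "{real_vec (k \<circ> e) | e. bij_betw e (UNIV :: 'n set) {1..CARD('n)}}"
  let ?L = "\<lambda>x :: real ^ 'n. \<chi> l. x $ Transposition.transpose i j l"
  have "linear ?L"
    by (auto intro!: linearI simp: vec_eq_iff)
  moreover have "?L ` ?S \<subseteq> ?S"
  proof safe
    fix e assume e: "bij_betw e (UNIV :: 'n set) {1..CARD('n)}"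
    have "bij_betw (e \<circ> Transposition.transpose i j) UNIV {1..CARD('n)}"
      using bij_transpose e by (rule bij_betw_trans)
    moreover have "?L (real_vec (k \<circ> e)) = real_vec (k \<circ> (e \<circ> Transposition.transpose i j))"
      by (simp add: vec_eq_iff)
    ultimately show "\<exists>e'. ?L (real_vec (k \<circ> e)) = real_vec (k \<circ> e') \<and> bij_betw e' UNIV {1..CARD('n)}"
      by blast
  qed
  ultimately have "?L ` (convex hull ?S) \<subseteq> convex hull ?S"
    by (simp add: convex_hull_linear_image hull_mono)
  then show ?thesis using assms by blast
qed

text \<open>
  Dominated vectors lie in the permutohedron since its points with natural coordinates form a
  smoothing-closed set.  In the other direction, the dominance inequalities define a convex set that
  contains the vertices.
\<close>

lemma permutohedron_integer_points:
  assumes k: "antimono k"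
  shows "permutohedron (real_vec (\<lambda>i. k (card {..i})) :: real ^ 'n::{finite,linorder}) \<inter> integer_points =
      real_vec ` {\<alpha>. dominated k \<alpha>}"
proof
  let ?S = "{real_vec (k \<circ> e) | e. bij_betw e (UNIV :: 'n set) {1..CARD('n)}}"
  note hull = permutohedron_eq_hull_rearrangements[where k = k and 'n = 'n]
  show "real_vec ` {\<alpha>. dominated k \<alpha>} \<subseteq>
      permutohedron (real_vec (\<lambda>i. k (card {..i})) :: (real, 'n) vec) \<inter> integer_points"
  proof safe
    fix \<alpha> :: "'n \<Rightarrow> nat" assume "dominated k \<alpha>"
    have "\<alpha> \<in> {\<alpha>. real_vec \<alpha> \<in> convex hull ?S}"
    proof (rule dominated_in_smoothing_closed[OF k _ _ \<open>dominated k \<alpha>\<close>])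
      show "smoothing_closed {\<alpha>. real_vec \<alpha> \<in> convex hull ?S}"
        using hull_rearrangements_swap by (intro smoothing_closed_convex convex_convex_hull)
      fix e assume "bij_betw e (UNIV :: 'n set) {1..CARD('n)}"
      then show "k \<circ> e \<in> {\<alpha>. real_vec \<alpha> \<in> convex hull ?S}"
        by (auto intro!: hull_inc)
    qed
    then show "real_vec \<alpha> \<in> permutohedron (real_vec (\<lambda>i. k (card {..i})))"
      unfolding hull by simp
    show "real_vec \<alpha> \<in> integer_points"
      by (simp add: integer_points_def)
  qed
  \<comment> \<open>Nonnegativity is included so that the integer points of \<open>H\<close> are vectors of naturals.\<close>
  define H :: "((real, 'n) vec) set" where
    "H = {x. (\<forall>i. 0 \<le> x $ i) \<and> (\<forall>A. (\<Sum>i\<in>A. x $ i) \<le> real (sum k {1..card A})) \<and>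
       (\<Sum>i\<in>UNIV. x $ i) = real (sum k {1..CARD('n)})}"
  have "convex H"
  proof (rule convexI)
    fix x y :: "(real, 'n) vec" and u v :: real
    assume x: "x \<in> H" and y: "y \<in> H" and uv: "0 \<le> u" "0 \<le> v" "u + v = 1"
    have sum: "(\<Sum>i\<in>A. (u *\<^sub>R x + v *\<^sub>R y) $ i) = u * (\<Sum>i\<in>A. x $ i) + v * (\<Sum>i\<in>A. y $ i)" for A
      by (simp add: sum.distrib sum_distrib_left)
    show "u *\<^sub>R x + v *\<^sub>R y \<in> H"
      unfolding H_def mem_Collect_eq sum
    proof (intro conjI allI)
      show "0 \<le> (u *\<^sub>R x + v *\<^sub>R y) $ i" for i
        using x y uv by (simp add: H_def)
      fix A
      have "(\<Sum>i\<in>A. x $ i) \<le> real (sum k {1..card A})" "(\<Sum>i\<in>A. y $ i) \<le> real (sum k {1..card A})"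
        using x y unfolding H_def by blast+
      then show "u * (\<Sum>i\<in>A. x $ i) + v * (\<Sum>i\<in>A. y $ i) \<le> real (sum k {1..card A})"
        using uv by (intro convex_bound_le)
    next
      have "(\<Sum>i\<in>UNIV. x $ i) = real (sum k {1..CARD('n)})" "(\<Sum>i\<in>UNIV. y $ i) = real (sum k {1..CARD('n)})"
        using x y unfolding H_def by blast+
      then show "u * (\<Sum>i\<in>UNIV. x $ i) + v * (\<Sum>i\<in>UNIV. y $ i) = real (sum k {1..CARD('n)})"
        using uv(3) by (simp only: distrib_right[symmetric] mult_1_left)
    qed
  qed
  moreover have "?S \<subseteq> H"
  proof safe
    fix e assume "bij_betw e (UNIV :: 'n set) {1..CARD('n)}"
    then have dom: "dominated k (k \<circ> e)" by (rule dominated_rearrangement[OF k])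
    have "real (sum (k \<circ> e) A) \<le> real (sum k {1..card A})" for A
      using dom unfolding dominated_def of_nat_le_iff by blast
    moreover have "real (sum (k \<circ> e) UNIV) = real (sum k {1..CARD('n)})"
      using dom unfolding dominated_def of_nat_eq_iff by blast
    ultimately show "real_vec (k \<circ> e) \<in> H"
      unfolding H_def by (simp del: of_nat_sum add: of_nat_sum[symmetric])
  qed
  ultimately have PH: "permutohedron (real_vec (\<lambda>i. k (card {..i})) :: (real, 'n) vec) \<subseteq> H"
    unfolding hull by (intro hull_minimal)
  show "permutohedron (real_vec (\<lambda>i. k (card {..i})) :: (real, 'n) vec) \<inter> integer_points \<subseteq>
      real_vec ` {\<alpha>. dominated k \<alpha>}"
  proof
    fix x assume "x \<in> permutohedron (real_vec (\<lambda>i. k (card {..i})) :: (real, 'n) vec) \<inter> integer_points"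
    then have H: "x \<in> H" and int: "x $ i \<in> \<int>" for i
      using PH by (auto simp: integer_points_def)
    define \<alpha> where "\<alpha> i = nat \<lfloor>x $ i\<rfloor>" for i
    have x: "real (\<alpha> i) = x $ i" for i
      using H int[of i] by (auto simp: \<alpha>_def H_def Ints_def)
    have "real (sum \<alpha> A) \<le> real (sum k {1..card A})" for A
      using H unfolding H_def of_nat_sum x by blast
    moreover have "real (sum \<alpha> UNIV) = real (sum k {1..CARD('n)})"
      using H unfolding H_def of_nat_sum x by blast
    ultimately have "dominated k \<alpha>"
      unfolding dominated_def of_nat_le_iff of_nat_eq_iff by blast
    moreover have "x = real_vec \<alpha>"
      by (simp add: vec_eq_iff x)
    ultimately show "x \<in> real_vec ` {\<alpha>. dominated k \<alpha>}" by blast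
  qed
qed

lemma permutohedron_eq_hull_dominated:
  assumes k: "antimono k"
  shows "permutohedron (real_vec (\<lambda>i. k (card {..i})) :: real ^ 'n::{finite,linorder}) =
      convex hull (real_vec ` {\<alpha>. dominated k \<alpha>})"
proof
  show "convex hull (real_vec ` {\<alpha>. dominated k \<alpha>}) \<subseteq>
      permutohedron (real_vec (\<lambda>i. k (card {..i})) :: (real, 'n) vec)"
    unfolding permutohedron_integer_points[OF k, symmetric]
    by (intro hull_minimal) (auto simp: permutohedron_def)
  show "permutohedron (real_vec (\<lambda>i. k (card {..i})) :: (real, 'n) vec) \<subseteq>
      convex hull (real_vec ` {\<alpha>. dominated k \<alpha>})"
    unfolding permutohedron_eq_hull_rearrangements
    using dominated_rearrangement[OF k] by (intro hull_mono) auto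
qed

section \<open>The columns of a skew shape\<close>

text \<open>
  The rows that meet column \<open>j\<close> form a finite initial segment, and an initial segment is determined
  by its cardinality.
\<close>

lemma less_conjugate_iff:
  assumes "is_partition f"
  shows "i < conjugate f j \<longleftrightarrow> j < f i"
proof -
  let ?S = "{i. j < f i}"
  have "finite {i. f i \<noteq> 0}" and anti: "antimono f"
    using assms by (auto simp: is_partition_def)
  then have fin: "finite ?S"
    by (rule_tac finite_subset) auto
  have down: "i \<in> ?S" if "i' \<in> ?S" "i \<le> i'" for i i'
    using that antimonoD[OF anti that(2)] by auto
  show ?thesis
  proof (cases "?S = {}")
    case True
    then show ?thesis by (auto simp: conjugate_def)
  next
    case False
    then have "Max ?S \<in> ?S" using fin by (intro Max_in)
    then have "?S = {..Max ?S}"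
      using down Max_ge[OF fin] by blast
    then have "conjugate f j = Suc (Max ?S)"
      unfolding conjugate_def by (metis card_atMost)
    with \<open>?S = {..Max ?S}\<close> show ?thesis
      by (metis (no_types, lifting) atMost_iff less_Suc_eq_le mem_Collect_eq)
  qed
qed

lemma conjugate_antimono:
  assumes "is_partition f" "j \<le> j'"
  shows "conjugate f j' \<le> conjugate f j"
proof (rule ccontr)
  assume "\<not> ?thesis"
  then have "j' < f (conjugate f j)"
    using less_conjugate_iff[OF assms(1), of "conjugate f j" j'] by simp
  then have "j < f (conjugate f j)"
    using assms(2) by simp
  then show False
    using less_conjugate_iff[OF assms(1)] by blast
qed

lemma kappa_antimono: "antimono (kappa lam mu)"
  unfolding kappa_def by (intro antimonoI card_mono) (auto simp: shape_columns_def)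

text \<open>Double counting of the pairs \<open>(p, j)\<close> with \<open>1 \<le> p \<le> m\<close> and \<open>p \<le> c\<^sub>j\<close>.\<close>

lemma sum_kappa: "(\<Sum>p=1..m. kappa lam mu p) = (\<Sum>j\<in>shape_columns lam. min m (col_len lam mu j))"
proof -
  have fin: "finite (shape_columns lam)" by (simp add: shape_columns_def)
  have "(\<Sum>p=1..m. kappa lam mu p) =
      (\<Sum>p=1..m. \<Sum>j\<in>shape_columns lam. if p \<le> col_len lam mu j then 1 else 0)"
    using fin by (simp add: kappa_def sum.If_cases Int_def)
  also have "\<dots> = (\<Sum>j\<in>shape_columns lam. \<Sum>p=1..m. if p \<le> col_len lam mu j then 1 else 0)"
    by (rule sum.swap)
  also have "\<dots> = (\<Sum>j\<in>shape_columns lam. min m (col_len lam mu j))"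
  proof (rule sum.cong)
    fix j
    have "{1..m} \<inter> {p. p \<le> col_len lam mu j} = {1..min m (col_len lam mu j)}" by auto
    then show "(\<Sum>p=1..m. if p \<le> col_len lam mu j then 1 else 0) = min m (col_len lam mu j)"
      by (simp add: sum.If_cases)
  qed simp
  finally show ?thesis .
qed

definition column_entries ::
    "(nat \<Rightarrow> nat) \<Rightarrow> (nat \<Rightarrow> nat) \<Rightarrow> (nat \<times> nat \<Rightarrow> 'n) \<Rightarrow> nat \<Rightarrow> 'n set" where
  "column_entries lam mu T j = (\<lambda>i. T (i, j)) ` {conjugate mu j..<conjugate lam j}"

definition content :: "(nat \<Rightarrow> nat) \<Rightarrow> (nat \<Rightarrow> nat) \<Rightarrow> (nat \<times> nat \<Rightarrow> 'n) \<Rightarrow> 'n \<Rightarrow> nat" where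
  "content lam mu T v = card {c \<in> cells lam mu. T c = v}"

lemma ssyt_row: "T \<in> ssyt lam mu \<Longrightarrow> (i, j) \<in> cells lam mu \<Longrightarrow> (i, j') \<in> cells lam mu \<Longrightarrow> j \<le> j' \<Longrightarrow>
    T (i, j) \<le> T (i, j')"
  by (cases "j = j'") (auto simp: ssyt_def)

lemma ssyt_column: "T \<in> ssyt lam mu \<Longrightarrow> (i, j) \<in> cells lam mu \<Longrightarrow> (i', j) \<in> cells lam mu \<Longrightarrow> i < i' \<Longrightarrow>
    T (i, j) < T (i', j)"
  by (auto simp: ssyt_def)

text \<open>
  This is used with \<open>E j\<close> the set of entries of column \<open>j\<close>, when one entry \<open>a\<close> in a column \<open>m\<close>
  without \<open>b\<close> turns into \<open>b\<close>.
\<close>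

lemma column_move_counts:
  fixes E :: "nat \<Rightarrow> 'n set"
  assumes "finite J" "m \<in> J" "a \<in> E m" "b \<notin> E m" "a \<noteq> b"
    and E': "E' = E(m := insert b (E m - {a}))"
  shows "card {j \<in> J. a \<in> E' j} + 1 = card {j \<in> J. a \<in> E j}"
    and "card {j \<in> J. b \<in> E' j} = card {j \<in> J. b \<in> E j} + 1"
    and "{j \<in> J. a \<in> E' j \<and> b \<in> E' j} = {j \<in> J. a \<in> E j \<and> b \<in> E j}"
    and "v \<noteq> a \<Longrightarrow> v \<noteq> b \<Longrightarrow> {j \<in> J. v \<in> E' j} = {j \<in> J. v \<in> E j}"
proof -
  have "{j \<in> J. a \<in> E j} = insert m {j \<in> J. a \<in> E' j}" "m \<notin> {j \<in> J. a \<in> E' j}"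
    using assms by auto
  then show "card {j \<in> J. a \<in> E' j} + 1 = card {j \<in> J. a \<in> E j}"
    using assms(1) by simp
  have "{j \<in> J. b \<in> E' j} = insert m {j \<in> J. b \<in> E j}" "m \<notin> {j \<in> J. b \<in> E j}"
    using assms by auto
  then show "card {j \<in> J. b \<in> E' j} = card {j \<in> J. b \<in> E j} + 1"
    using assms(1) by simp
  show "{j \<in> J. a \<in> E' j \<and> b \<in> E' j} = {j \<in> J. a \<in> E j \<and> b \<in> E j}"
    using assms by auto
  show "v \<noteq> a \<Longrightarrow> v \<noteq> b \<Longrightarrow> {j \<in> J. v \<in> E' j} = {j \<in> J. v \<in> E j}"
    using assms by auto
qed

context
  fixes lam mu :: "nat \<Rightarrow> nat"
  assumes shape: "is_skew_shape lam mu"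
begin

text \<open>
  In terms of the conjugates a column is an interval of rows, which suits arguments that go column by
  column.
\<close>

lemma cells_iff: "(i, j) \<in> cells lam mu \<longleftrightarrow> conjugate mu j \<le> i \<and> i < conjugate lam j"
  using shape less_conjugate_iff[of mu i j] less_conjugate_iff[of lam i j]
  by (auto simp: is_skew_shape_def cells_def)

lemma conjugate_mu_antimono: "j \<le> j' \<Longrightarrow> conjugate mu j' \<le> conjugate mu j"
  and conjugate_lam_antimono: "j \<le> j' \<Longrightarrow> conjugate lam j' \<le> conjugate lam j"
  using shape by (auto simp: is_skew_shape_def intro: conjugate_antimono)

lemma cell_column_in_shape:
  assumes "(i, j) \<in> cells lam mu"
  shows "j \<in> shape_columns lam"
proof -
  have "lam i \<le> lam 0"
    using shape by (auto simp: is_skew_shape_def is_partition_def intro: antimonoD)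
  then show ?thesis using assms by (auto simp: cells_def shape_columns_def)
qed

lemma cells_eq_columns:
  "cells lam mu = (\<lambda>(j, i). (i, j)) `
     (SIGMA j:shape_columns lam. {conjugate mu j..<conjugate lam j})"
  using cells_iff cell_column_in_shape by (force simp: image_iff)

lemma finite_cells: "finite (cells lam mu)"
  unfolding cells_eq_columns by (auto simp: shape_columns_def)

lemma sum_cells:
  "sum g (cells lam mu) =
     (\<Sum>j\<in>shape_columns lam. \<Sum>i\<in>{conjugate mu j..<conjugate lam j}. g (i, j))"
proof -
  have "inj_on (\<lambda>(j, i). (i, j)) (SIGMA j:shape_columns lam. {conjugate mu j..<conjugate lam j})"
    by (auto simp: inj_on_def)
  then have "sum g (cells lam mu) =
      (\<Sum>(j, i)\<in>(SIGMA j:shape_columns lam. {conjugate mu j..<conjugate lam j}). g (i, j))"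
    unfolding cells_eq_columns by (simp add: sum.reindex case_prod_unfold)
  also have "\<dots> = (\<Sum>j\<in>shape_columns lam. \<Sum>i\<in>{conjugate mu j..<conjugate lam j}. g (i, j))"
    by (subst sum.Sigma) (auto simp: shape_columns_def)
  finally show ?thesis .
qed

section \<open>Contents are dominated\<close>

lemma column_entries_iff:
  "v \<in> column_entries lam mu T j \<longleftrightarrow> (\<exists>i. (i, j) \<in> cells lam mu \<and> T (i, j) = v)"
  by (auto simp: column_entries_def cells_iff)

lemma inj_on_column:
  assumes "T \<in> ssyt lam mu"
  shows "inj_on (\<lambda>i. T (i, j)) {conjugate mu j..<conjugate lam j}"
proof (rule inj_onI)
  fix i i' assume "i \<in> {conjugate mu j..<conjugate lam j}" "i' \<in> {conjugate mu j..<conjugate lam j}"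
    and eq: "T (i, j) = T (i', j)"
  then have "(i, j) \<in> cells lam mu" "(i', j) \<in> cells lam mu"
    by (auto simp: cells_iff)
  with eq show "i = i'"
    using ssyt_column[OF assms] by (metis less_irrefl linorder_neqE_nat)
qed

lemma card_column_entries: "T \<in> ssyt lam mu \<Longrightarrow> card (column_entries lam mu T j) = col_len lam mu j"
  unfolding column_entries_def by (simp add: card_image inj_on_column col_len_def)

lemma sum_content:
  fixes T :: "nat \<times> nat \<Rightarrow> 'n::{finite,linorder}"
  assumes T: "T \<in> ssyt lam mu"
  shows "sum (content lam mu T) A = (\<Sum>j\<in>shape_columns lam. card (column_entries lam mu T j \<inter> A))"
proof -
  have "sum (content lam mu T) A = card (\<Union>v\<in>A. {c \<in> cells lam mu. T c = v})"
    unfolding content_def by (subst card_UN_disjoint) (auto simp: finite_cells)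
  also have "(\<Union>v\<in>A. {c \<in> cells lam mu. T c = v}) = cells lam mu \<inter> {c. T c \<in> A}"
    by auto
  also have "card \<dots> = (\<Sum>c\<in>cells lam mu. if T c \<in> A then 1 else 0)"
    using finite_cells by (simp add: sum.If_cases)
  also have "\<dots> = (\<Sum>j\<in>shape_columns lam. card (column_entries lam mu T j \<inter> A))"
    unfolding sum_cells
  proof (rule sum.cong)
    fix j
    let ?I = "{conjugate mu j..<conjugate lam j} \<inter> {i. T (i, j) \<in> A}"
    have "column_entries lam mu T j \<inter> A = (\<lambda>i. T (i, j)) ` ?I"
      by (auto simp: column_entries_def)
    moreover have "inj_on (\<lambda>i. T (i, j)) ?I"
      using inj_on_column[OF T] by (rule inj_on_subset) auto
    ultimately show "(\<Sum>i\<in>{conjugate mu j..<conjugate lam j}. if T (i, j) \<in> A then 1 else 0) =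
        card (column_entries lam mu T j \<inter> A)"
      by (simp add: sum.If_cases card_image)
  qed simp
  finally show ?thesis .
qed

lemma content_eq_card_columns:
  fixes T :: "nat \<times> nat \<Rightarrow> 'n::{finite,linorder}"
  assumes "T \<in> ssyt lam mu"
  shows "content lam mu T v = card {j \<in> shape_columns lam. v \<in> column_entries lam mu T j}"
proof -
  have "content lam mu T v = (\<Sum>j\<in>shape_columns lam. card (column_entries lam mu T j \<inter> {v}))"
    using sum_content[OF assms, of "{v}"] by simp
  also have "\<dots> = (\<Sum>j\<in>shape_columns lam. if v \<in> column_entries lam mu T j then 1 else 0)"
    by (intro sum.cong) auto
  finally show ?thesis
    by (simp add: sum.If_cases shape_columns_def Int_def)
qed

text \<open>
  A column holds at most \<open>min {|A|, c\<^sub>j}\<close> entries from \<open>A\<close>, and all of its \<open>c\<^sub>j\<close> entries are in the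
  alphabet.
\<close>

lemma content_dominated:
  fixes T :: "nat \<times> nat \<Rightarrow> 'n::{finite,linorder}"
  assumes T: "T \<in> ssyt lam mu"
  shows "dominated (kappa lam mu) (content lam mu T)"
  unfolding dominated_def
proof (intro conjI allI)
  fix A
  have "card (column_entries lam mu T j \<inter> A) \<le> min (card A) (col_len lam mu j)" for j
    unfolding card_column_entries[OF T, symmetric] by (simp add: card_mono)
  then show "sum (content lam mu T) A \<le> (\<Sum>p=1..card A. kappa lam mu p)"
    unfolding sum_content[OF T] sum_kappa by (intro sum_mono)
  have "card (column_entries lam mu T j) \<le> CARD('n)" for j
    by (simp add: card_mono)
  then show "sum (content lam mu T) UNIV = (\<Sum>p=1..CARD('n). kappa lam mu p)"
    unfolding sum_content[OF T] sum_kappa card_column_entries[OF T, symmetric] by simp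
qed

section \<open>Contents are closed under smoothing\<close>

lemma column_entries_upd:
  assumes T: "T \<in> ssyt lam mu" and c: "(i, j) \<in> cells lam mu"
  shows "column_entries lam mu (T((i, j) := v)) j' =
    (if j' = j then insert v (column_entries lam mu T j - {T (i, j)}) else column_entries lam mu T j')"
proof (cases "j' = j")
  case True
  let ?I = "{conjugate mu j..<conjugate lam j}"
  let ?E = "(\<lambda>i'. T (i', j)) ` (?I - {i})"
  have I: "insert i (?I - {i}) = ?I"
    using c by (auto simp: cells_iff)
  have "T (i, j) \<notin> ?E"
    using inj_on_column[OF T, of j] c by (auto simp: inj_on_def cells_iff)
  moreover have "column_entries lam mu T j = insert (T (i, j)) ?E"
    unfolding column_entries_def
    using image_insert[of "\<lambda>i'. T (i', j)" i "?I - {i}"] by (simp only: I)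
  moreover have "column_entries lam mu (T((i, j) := v)) j = insert v ?E"
    unfolding column_entries_def
    using image_insert[of "\<lambda>i'. (T((i, j) := v)) (i', j)" i "?I - {i}"] by (simp only: I) auto
  ultimately show ?thesis using True by auto
next
  case False
  then show ?thesis by (auto simp: column_entries_def)
qed

lemma ssyt_upd:
  fixes T :: "nat \<times> nat \<Rightarrow> 'n::linorder"
  assumes T: "T \<in> ssyt lam mu" and c: "(i, j) \<in> cells lam mu"
    and left: "\<And>j'. (i, j') \<in> cells lam mu \<Longrightarrow> j' < j \<Longrightarrow> T (i, j') \<le> v"
    and right: "\<And>j'. (i, j') \<in> cells lam mu \<Longrightarrow> j < j' \<Longrightarrow> v \<le> T (i, j')"
    and above: "\<And>i'. (i', j) \<in> cells lam mu \<Longrightarrow> i' < i \<Longrightarrow> T (i', j) < v"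
    and below: "\<And>i'. (i', j) \<in> cells lam mu \<Longrightarrow> i < i' \<Longrightarrow> v < T (i', j)"
  shows "T((i, j) := v) \<in> ssyt lam mu"
  unfolding ssyt_def mem_Collect_eq
proof (intro conjI allI impI)
  have "T \<in> extensional (cells lam mu)"
    using T by (auto simp: ssyt_def PiE_def)
  then show "T((i, j) := v) \<in> cells lam mu \<rightarrow>\<^sub>E UNIV"
    using c by (auto simp: PiE_def extensional_def)
next
  fix i1 j1 j2
  assume "(i1, j1) \<in> cells lam mu" "(i1, j2) \<in> cells lam mu" "j1 < j2"
  then show "(T((i, j) := v)) (i1, j1) \<le> (T((i, j) := v)) (i1, j2)"
    using ssyt_row[OF T, of i1 j1 j2] left[of j1] right[of j2] by auto
next
  fix i1 i2 j1
  assume "(i1, j1) \<in> cells lam mu" "(i2, j1) \<in> cells lam mu" "i1 < i2"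
  then show "(T((i, j) := v)) (i1, j1) < (T((i, j) := v)) (i2, j1)"
    using ssyt_column[OF T, of i1 j1 i2] above[of i1] below[of i2] by auto
qed

text \<open>
  For letters \<open>a < b\<close> with nothing in between, choose a row in which some \<open>a\<close> has no \<open>b\<close> in its
  column, and take the last \<open>a\<close> of this row, in column \<open>m\<close>.  If column \<open>m\<close> contained \<open>b\<close>, this
  \<open>b\<close> would stand directly below, and the skew shape would also have a cell below the chosen \<open>a\<close>, to
  the left of it; its entry would be squeezed between \<open>a\<close> and \<open>b\<close> and so be \<open>b\<close>.  Hence the last \<open>a\<close>
  may be replaced by \<open>b\<close>.
\<close>

lemma ssyt_raise_entry:
  fixes T :: "nat \<times> nat \<Rightarrow> 'n::linorder"
  assumes T: "T \<in> ssyt lam mu" and "a < b" and adj: "\<And>c. a < c \<Longrightarrow> b \<le> c"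
    and j: "a \<in> column_entries lam mu T j" "b \<notin> column_entries lam mu T j"
  obtains T' j' where "T' \<in> ssyt lam mu"
    "a \<in> column_entries lam mu T j'" "b \<notin> column_entries lam mu T j'"
    "column_entries lam mu T' = (column_entries lam mu T)(j' := insert b (column_entries lam mu T j' - {a}))"
proof -
  obtain i where i: "(i, j) \<in> cells lam mu" "T (i, j) = a"
    using j(1) by (auto simp: column_entries_iff)
  define J where "J = {j'. (i, j') \<in> cells lam mu \<and> T (i, j') = a}"
  have "J \<subseteq> shape_columns lam"
    using cell_column_in_shape by (auto simp: J_def)
  then have "finite J"
    by (rule finite_subset) (simp add: shape_columns_def)
  define m where "m = Max J"
  have "j \<in> J" using i by (simp add: J_def)
  then have "m \<in> J" and "j \<le> m"
    unfolding m_def using \<open>finite J\<close> by (auto intro: Max_in)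
  then have m: "(i, m) \<in> cells lam mu" "T (i, m) = a"
    by (auto simp: J_def)
  have bm: "b \<notin> column_entries lam mu T m"
  proof
    assume "b \<in> column_entries lam mu T m"
    then obtain i' where i': "(i', m) \<in> cells lam mu" "T (i', m) = b"
      by (auto simp: column_entries_iff)
    have "i < i'"
      using ssyt_column[OF T i'(1) m(1)] i'(2) m(2) \<open>a < b\<close>
      by (metis less_asym linorder_neqE_nat order_less_irrefl)
    \<comment> \<open>Columns have no gaps, and a column further to the left ends at least as low.\<close>
    then have cm: "(Suc i, m) \<in> cells lam mu"
      using i'(1) m(1) by (auto simp: cells_iff)
    then have cj: "(Suc i, j) \<in> cells lam mu"
      using i(1) conjugate_lam_antimono[OF \<open>j \<le> m\<close>] by (auto simp: cells_iff)
    have "T (Suc i, m) \<le> b"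
      using ssyt_column[OF T cm i'(1)] i'(2) \<open>i < i'\<close> by (cases "Suc i = i'") auto
    then have "T (Suc i, j) \<le> b"
      using ssyt_row[OF T cj cm \<open>j \<le> m\<close>] by simp
    moreover have "b \<le> T (Suc i, j)"
      using ssyt_column[OF T i(1) cj] i(2) adj by simp
    ultimately show False
      using j(2) cj by (auto simp: column_entries_iff)
  qed
  have "T((i, m) := b) \<in> ssyt lam mu"
  proof (rule ssyt_upd[OF T m(1)])
    show "T (i, j') \<le> b" if "(i, j') \<in> cells lam mu" "j' < m" for j'
      using ssyt_row[OF T that(1) m(1)] that m(2) \<open>a < b\<close> by simp
    show "b \<le> T (i, j')" if "(i, j') \<in> cells lam mu" "m < j'" for j'
    proof -
      have "j' \<notin> J"
        using that Max_ge[OF \<open>finite J\<close>, of j'] by (auto simp: m_def)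
      then have "T (i, j') \<noteq> a"
        using that by (simp add: J_def)
      moreover have "a \<le> T (i, j')"
        using ssyt_row[OF T m(1) that(1)] that m(2) by simp
      ultimately show ?thesis using adj by simp
    qed
    show "T (i', m) < b" if "(i', m) \<in> cells lam mu" "i' < i" for i'
      using ssyt_column[OF T that(1) m(1) that(2)] m(2) \<open>a < b\<close> by simp
    show "b < T (i', m)" if "(i', m) \<in> cells lam mu" "i < i'" for i'
    proof -
      have "b \<le> T (i', m)"
        using ssyt_column[OF T m(1) that] m(2) adj by simp
      moreover have "T (i', m) \<noteq> b"
        using bm that(1) by (auto simp: column_entries_iff)
      ultimately show ?thesis by simp
    qed
  qed
  moreover have "a \<in> column_entries lam mu T m"
    using m by (auto simp: column_entries_iff)
  moreover have "column_entries lam mu (T((i, m) := b)) =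
      (column_entries lam mu T)(m := insert b (column_entries lam mu T m - {a}))"
    using column_entries_upd[OF T m(1)] m(2) by (auto simp: fun_eq_iff)
  ultimately show ?thesis using bm that by blast
qed

text \<open>
  The mirror image of the previous lemma: the first \<open>b\<close> of the row takes the place of the last \<open>a\<close>,
  and the cells above take the place of the cells below.
\<close>

lemma ssyt_lower_entry:
  fixes T :: "nat \<times> nat \<Rightarrow> 'n::linorder"
  assumes T: "T \<in> ssyt lam mu" and "a < b" and adj: "\<And>c. c < b \<Longrightarrow> c \<le> a"
    and j: "b \<in> column_entries lam mu T j" "a \<notin> column_entries lam mu T j"
  obtains T' j' where "T' \<in> ssyt lam mu"
    "b \<in> column_entries lam mu T j'" "a \<notin> column_entries lam mu T j'"
    "column_entries lam mu T' = (column_entries lam mu T)(j' := insert a (column_entries lam mu T j' - {b}))"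
proof -
  obtain i where i: "(i, j) \<in> cells lam mu" "T (i, j) = b"
    using j(1) by (auto simp: column_entries_iff)
  define J where "J = {j'. (i, j') \<in> cells lam mu \<and> T (i, j') = b}"
  have "J \<subseteq> shape_columns lam"
    using cell_column_in_shape by (auto simp: J_def)
  then have "finite J"
    by (rule finite_subset) (simp add: shape_columns_def)
  define m where "m = Min J"
  have "j \<in> J" using i by (simp add: J_def)
  then have "m \<in> J" and "m \<le> j"
    unfolding m_def using \<open>finite J\<close> by (auto intro: Min_in)
  then have m: "(i, m) \<in> cells lam mu" "T (i, m) = b"
    by (auto simp: J_def)
  have am: "a \<notin> column_entries lam mu T m"
  proof
    assume "a \<in> column_entries lam mu T m"
    then obtain i' where i': "(i', m) \<in> cells lam mu" "T (i', m) = a"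
      by (auto simp: column_entries_iff)
    have "i' < i"
      using ssyt_column[OF T m(1) i'(1)] i'(2) m(2) \<open>a < b\<close>
      by (metis less_asym linorder_neqE_nat order_less_irrefl)
    \<comment> \<open>A column further to the right starts at least as high.\<close>
    then have cm: "(i - 1, m) \<in> cells lam mu" and "i' \<le> i - 1" and "i - 1 < i"
      using i'(1) m(1) by (auto simp: cells_iff)
    then have cj: "(i - 1, j) \<in> cells lam mu"
      using i(1) conjugate_mu_antimono[OF \<open>m \<le> j\<close>] by (auto simp: cells_iff)
    have "a \<le> T (i - 1, m)"
      using ssyt_column[OF T i'(1) cm] i'(2) \<open>i' \<le> i - 1\<close> by (cases "i' = i - 1") auto
    then have "a \<le> T (i - 1, j)"
      using ssyt_row[OF T cm cj \<open>m \<le> j\<close>] by simp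
    moreover have "T (i - 1, j) \<le> a"
      using ssyt_column[OF T cj i(1) \<open>i - 1 < i\<close>] i(2) adj by simp
    ultimately show False
      using j(2) cj by (auto simp: column_entries_iff)
  qed
  have "T((i, m) := a) \<in> ssyt lam mu"
  proof (rule ssyt_upd[OF T m(1)])
    show "a \<le> T (i, j')" if "(i, j') \<in> cells lam mu" "m < j'" for j'
      using ssyt_row[OF T m(1) that(1)] that m(2) \<open>a < b\<close> by simp
    show "T (i, j') \<le> a" if "(i, j') \<in> cells lam mu" "j' < m" for j'
    proof -
      have "j' \<notin> J"
        using that Min_le[OF \<open>finite J\<close>, of j'] by (auto simp: m_def)
      then have "T (i, j') \<noteq> b"
        using that by (simp add: J_def)
      moreover have "T (i, j') \<le> b"
        using ssyt_row[OF T that(1) m(1)] that m(2) by simp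
      ultimately show ?thesis using adj by simp
    qed
    show "a < T (i', m)" if "(i', m) \<in> cells lam mu" "i < i'" for i'
      using ssyt_column[OF T m(1) that] m(2) \<open>a < b\<close> by simp
    show "T (i', m) < a" if "(i', m) \<in> cells lam mu" "i' < i" for i'
    proof -
      have "T (i', m) \<le> a"
        using ssyt_column[OF T that(1) m(1) that(2)] m(2) adj by simp
      moreover have "T (i', m) \<noteq> a"
        using am that(1) by (auto simp: column_entries_iff)
      ultimately show ?thesis by simp
    qed
  qed
  moreover have "b \<in> column_entries lam mu T m"
    using m by (auto simp: column_entries_iff)
  moreover have "column_entries lam mu (T((i, m) := a)) =
      (column_entries lam mu T)(m := insert a (column_entries lam mu T m - {b}))"
    using column_entries_upd[OF T m(1)] m(2) by (auto simp: fun_eq_iff)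
  ultimately show ?thesis using am that by blast
qed

text \<open>
  The number of columns that contain both letters does not change when an unpaired entry is
  replaced, and it bounds from below how far the content of either letter can be decreased: as long as the
  content of a letter exceeds this number, there is an unpaired entry to replace.
\<close>

lemma ssyt_content_smoothing:
  fixes T :: "nat \<times> nat \<Rightarrow> 'n::{finite,linorder}"
  assumes "T \<in> ssyt lam mu" and "a < b" and adj: "{a<..<b} = {}"
    and "x + y = content lam mu T a + content lam mu T b"
    and "card {j \<in> shape_columns lam. a \<in> column_entries lam mu T j \<and> b \<in> column_entries lam mu T j} \<le> min x y"
  shows "\<exists>T'\<in>ssyt lam mu. content lam mu T' = (content lam mu T)(a := x, b := y)"
  using assms(1,4,5)
proof (induction "(content lam mu T a - x) + (x - content lam mu T a)" arbitrary: T rule: less_induct)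
  case (less T)
  let ?J = "shape_columns lam" and ?E = "column_entries lam mu" and ?c = "content lam mu"
  note T = less.prems(1)
  have fin: "finite ?J" by (simp add: shape_columns_def)
  have c: "?c T v = card {j \<in> ?J. v \<in> ?E T j}" if "T \<in> ssyt lam mu" for T :: "nat \<times> nat \<Rightarrow> 'n" and v
    using content_eq_card_columns[OF that] .
  have in_J: "j \<in> ?J" if "v \<in> ?E T j" for v j
    using that cell_column_in_shape by (auto simp: column_entries_iff)
  have between: "\<not> (a < c \<and> c < b)" for c
    unfolding greaterThanLessThan_iff[symmetric] adj by simp
  have up: "b \<le> c" if "a < c" for c
    using that between[of c] by simp
  have down: "c \<le> a" if "c < b" for c
    using that between[of c] by simp
  consider "?c T a = x" | "x < ?c T a" | "?c T a < x" by linarith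
  then show ?case
  proof cases
    case 1
    then have "?c T = (?c T)(a := x, b := y)"
      using less.prems(2) by auto
    then show ?thesis using T by metis
  next
    case 2
    have "\<not> {j \<in> ?J. a \<in> ?E T j} \<subseteq> {j \<in> ?J. a \<in> ?E T j \<and> b \<in> ?E T j}"
    proof
      assume "{j \<in> ?J. a \<in> ?E T j} \<subseteq> {j \<in> ?J. a \<in> ?E T j \<and> b \<in> ?E T j}"
      then have "?c T a \<le> card {j \<in> ?J. a \<in> ?E T j \<and> b \<in> ?E T j}"
        unfolding c[OF T] using fin by (intro card_mono) auto
      with 2 less.prems(3) show False by simp
    qed
    then obtain j where "a \<in> ?E T j" "b \<notin> ?E T j" by auto
    from ssyt_raise_entry[OF T \<open>a < b\<close> up this]
    obtain T' m where T': "T' \<in> ssyt lam mu" and m: "a \<in> ?E T m" "b \<notin> ?E T m"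
      and E': "?E T' = (?E T)(m := insert b (?E T m - {a}))" .
    note mv = column_move_counts[OF fin in_J[OF m(1)] m less_imp_neq[OF \<open>a < b\<close>] E']
    have ca: "?c T' a + 1 = ?c T a" and cb: "?c T' b = ?c T b + 1"
      and cv: "\<And>v. v \<noteq> a \<Longrightarrow> v \<noteq> b \<Longrightarrow> ?c T' v = ?c T v"
      using mv by (simp_all add: c T T')
    have "\<exists>T''\<in>ssyt lam mu. ?c T'' = (?c T')(a := x, b := y)"
      using ca cb 2 less.prems(2,3) mv(3) by (intro less.hyps T') auto
    moreover have "(?c T')(a := x, b := y) = (?c T)(a := x, b := y)"
      using cv by (auto simp: fun_eq_iff)
    ultimately show ?thesis by simp
  next
    case 3
    have "\<not> {j \<in> ?J. b \<in> ?E T j} \<subseteq> {j \<in> ?J. a \<in> ?E T j \<and> b \<in> ?E T j}"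
    proof
      assume "{j \<in> ?J. b \<in> ?E T j} \<subseteq> {j \<in> ?J. a \<in> ?E T j \<and> b \<in> ?E T j}"
      then have "?c T b \<le> card {j \<in> ?J. a \<in> ?E T j \<and> b \<in> ?E T j}"
        unfolding c[OF T] using fin by (intro card_mono) auto
      with 3 less.prems(2,3) show False by simp
    qed
    then obtain j where "b \<in> ?E T j" "a \<notin> ?E T j" by auto
    from ssyt_lower_entry[OF T \<open>a < b\<close> down this]
    obtain T' m where T': "T' \<in> ssyt lam mu" and m: "b \<in> ?E T m" "a \<notin> ?E T m"
      and E': "?E T' = (?E T)(m := insert a (?E T m - {b}))" .
    note mv = column_move_counts[OF fin in_J[OF m(1)] m less_imp_neq[OF \<open>a < b\<close>, symmetric] E']
    have cb: "?c T' b + 1 = ?c T b" and ca: "?c T' a = ?c T a + 1"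
      and cv: "\<And>v. v \<noteq> a \<Longrightarrow> v \<noteq> b \<Longrightarrow> ?c T' v = ?c T v"
      using mv by (simp_all add: c T T')
    have "\<exists>T''\<in>ssyt lam mu. ?c T'' = (?c T')(a := x, b := y)"
      using ca cb 3 less.prems(2,3) mv(3) by (intro less.hyps T') (auto simp: conj_commute)
    moreover have "(?c T')(a := x, b := y) = (?c T)(a := x, b := y)"
      using cv by (auto simp: fun_eq_iff)
    ultimately show ?thesis by simp
  qed
qed

lemma contents_smoothing_closed:
  "smoothing_closed (content lam mu ` (ssyt lam mu :: (nat \<times> nat \<Rightarrow> 'n::{finite,linorder}) set))"
proof (rule smoothing_closed_if_adjacent)
  fix \<alpha> :: "'n \<Rightarrow> nat" and i j :: 'n and x y
  assume "\<alpha> \<in> content lam mu ` ssyt lam mu" "i < j" "{i<..<j} = {}" "x + y = \<alpha> i + \<alpha> j"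
    "min (\<alpha> i) (\<alpha> j) \<le> x" "min (\<alpha> i) (\<alpha> j) \<le> y"
  then obtain T :: "nat \<times> nat \<Rightarrow> 'n" where T: "T \<in> ssyt lam mu" and \<alpha>: "\<alpha> = content lam mu T" by auto
  let ?m = "card {l \<in> shape_columns lam. i \<in> column_entries lam mu T l \<and> j \<in> column_entries lam mu T l}"
  have "?m \<le> \<alpha> i" "?m \<le> \<alpha> j"
    unfolding \<alpha> content_eq_card_columns[OF T]
    by (auto intro!: card_mono simp: shape_columns_def)
  then have "?m \<le> min x y"
    using \<open>min (\<alpha> i) (\<alpha> j) \<le> x\<close> \<open>min (\<alpha> i) (\<alpha> j) \<le> y\<close> by linarith
  then have "\<exists>T'\<in>ssyt lam mu. content lam mu T' = \<alpha>(i := x, j := y)"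
    using ssyt_content_smoothing[OF T \<open>i < j\<close> \<open>{i<..<j} = {}\<close>] \<open>x + y = \<alpha> i + \<alpha> j\<close>
    unfolding \<alpha> by simp
  then show "\<alpha>(i := x, j := y) \<in> content lam mu ` ssyt lam mu"
    by force
qed

section \<open>All dominated vectors are contents\<close>

text \<open>
  The tableau has entries \<open>1, 2, \<dots>\<close> down each column.  Its rows increase weakly because the columns
  start higher up from left to right.
\<close>

lemma kappa_is_content:
  assumes short: "\<And>j. j \<in> shape_columns lam \<Longrightarrow> col_len lam mu j \<le> CARD('n::{finite,linorder})"
  shows "kappa lam mu \<circ> (\<lambda>i::'n. card {..i}) \<in> content lam mu ` ssyt lam mu"
proof -
  \<comment> \<open>The letter at a given position; the hypothesis on the columns keeps the positions at most \<open>n\<close>.\<close>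
  define entry where "entry = inv_into UNIV (\<lambda>i::'n. card {..i})"
  define T where "T = restrict (\<lambda>(i, j). entry (i - conjugate mu j + 1)) (cells lam mu)"
  have entry: "card {..entry p} = p" if "1 \<le> p" "p \<le> CARD('n)" for p
  proof -
    have "p \<in> range (\<lambda>i::'n. card {..i})"
      unfolding bij_betw_imp_surj_on[OF bij_betw_card_atMost] using that by simp
    then show ?thesis
      unfolding entry_def by (rule f_inv_into_f[where f = "\<lambda>i. card {..i}"])
  qed
  have T: "card {..T (i, j)} = i - conjugate mu j + 1" if "(i, j) \<in> cells lam mu" for i j
  proof -
    have "i - conjugate mu j + 1 \<le> col_len lam mu j"
      using that by (auto simp: cells_iff col_len_def)
    also have "\<dots> \<le> CARD('n)"
      using short cell_column_in_shape[OF that] by blast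
    finally show ?thesis using that by (simp add: T_def entry)
  qed
  have "T \<in> ssyt lam mu"
    unfolding ssyt_def mem_Collect_eq
  proof (intro conjI allI impI)
    show "T \<in> cells lam mu \<rightarrow>\<^sub>E UNIV" by (auto simp: T_def)
  next
    fix i j j' assume c: "(i, j) \<in> cells lam mu" "(i, j') \<in> cells lam mu" "j < j'"
    then have "card {..T (i, j)} \<le> card {..T (i, j')}"
      using T conjugate_mu_antimono[of j j'] by simp
    then show "T (i, j) \<le> T (i, j')"
      by (simp add: card_atMost_less_iff flip: not_less)
  next
    fix i i' j assume c: "(i, j) \<in> cells lam mu" "(i', j) \<in> cells lam mu" "i < i'"
    then have "card {..T (i, j)} < card {..T (i', j)}"
      using T by (auto simp: cells_iff)
    then show "T (i, j) < T (i', j)"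
      by (simp add: card_atMost_less_iff)
  qed
  have "content lam mu T v = kappa lam mu (card {..v})" for v
  proof -
    have v: "1 \<le> card {..v}"
      using bij_betwE[OF bij_betw_card_atMost[where 'n='n]] by auto
    have "v \<in> column_entries lam mu T j \<longleftrightarrow> card {..v} \<le> col_len lam mu j" for j
    proof
      assume "v \<in> column_entries lam mu T j"
      then obtain i where "(i, j) \<in> cells lam mu" "T (i, j) = v"
        by (auto simp: column_entries_iff)
      with T[of i j] show "card {..v} \<le> col_len lam mu j"
        by (auto simp: cells_iff col_len_def)
    next
      assume le: "card {..v} \<le> col_len lam mu j"
      define i where "i = conjugate mu j + card {..v} - 1"
      have c: "(i, j) \<in> cells lam mu"
        using le v by (auto simp: cells_iff col_len_def i_def)
      have "card {..T (i, j)} = card {..v}"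
        using T[OF c] v by (simp add: i_def)
      then have "T (i, j) = v"
        using card_atMost_less_iff by (metis less_irrefl linorder_neqE)
      with c show "v \<in> column_entries lam mu T j"
        by (auto simp: column_entries_iff)
    qed
    then show ?thesis
      using content_eq_card_columns[OF \<open>T \<in> ssyt lam mu\<close>] by (simp add: kappa_def)
  qed
  then have "content lam mu T = kappa lam mu \<circ> (\<lambda>i. card {..i})"
    by (simp add: fun_eq_iff)
  with \<open>T \<in> ssyt lam mu\<close> show ?thesis by (metis image_eqI)
qed

lemma contents_eq_dominated:
  assumes short: "\<And>j. j \<in> shape_columns lam \<Longrightarrow> col_len lam mu j \<le> CARD('n::{finite,linorder})"
  shows "content lam mu ` ssyt lam mu = {\<alpha> :: 'n \<Rightarrow> nat. dominated (kappa lam mu) \<alpha>}"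
proof safe
  fix T :: "nat \<times> nat \<Rightarrow> 'n" assume "T \<in> ssyt lam mu"
  then show "dominated (kappa lam mu) (content lam mu T)"
    by (rule content_dominated)
next
  fix \<alpha> :: "'n \<Rightarrow> nat" assume \<alpha>: "dominated (kappa lam mu) \<alpha>"
  have base: "kappa lam mu \<circ> (\<lambda>i::'n. card {..i}) \<in> content lam mu ` ssyt lam mu"
    using short by (rule kappa_is_content)
  show "\<alpha> \<in> content lam mu ` ssyt lam mu"
  proof (rule dominated_in_smoothing_closed[OF kappa_antimono contents_smoothing_closed _ \<alpha>])
    fix e :: "'n \<Rightarrow> nat"
    assume "bij_betw e UNIV {1..CARD('n)}"
    then show "kappa lam mu \<circ> e \<in> content lam mu ` ssyt lam mu"
      using smoothing_closed_rearrange[OF contents_smoothing_closed base bij_betw_card_atMost] by blast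
  qed
qed

section \<open>Uniqueness of tableaux of extreme content\<close>

text \<open>A column lists its set of entries in increasing order.\<close>

lemma ssyt_eqI:
  fixes T T' :: "nat \<times> nat \<Rightarrow> 'n::linorder"
  assumes T: "T \<in> ssyt lam mu" and T': "T' \<in> ssyt lam mu"
    and eq: "\<And>j. j \<in> shape_columns lam \<Longrightarrow> column_entries lam mu T j = column_entries lam mu T' j"
  shows "T = T'"
proof (rule extensionalityI)
  show "T \<in> extensional (cells lam mu)" "T' \<in> extensional (cells lam mu)"
    using T T' by (auto simp: ssyt_def PiE_def)
  fix c assume "c \<in> cells lam mu"
  then obtain i j where c: "c = (i, j)" "(i, j) \<in> cells lam mu" by (cases c) auto
  let ?xs = "[conjugate mu j..<conjugate lam j]"
  have sorted: "sorted_wrt (<) (map (\<lambda>i. S (i, j)) ?xs)" if "S \<in> ssyt lam mu" for S :: "nat \<times> nat \<Rightarrow> 'n"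
    unfolding sorted_wrt_map
    by (rule sorted_wrt_mono_rel[OF _ sorted_wrt_upt])
      (auto intro: ssyt_column[OF that] simp: cells_iff)
  have "set (map (\<lambda>i. T (i, j)) ?xs) = set (map (\<lambda>i. T' (i, j)) ?xs)"
    using eq[OF cell_column_in_shape[OF c(2)]] by (simp add: column_entries_def)
  then have "map (\<lambda>i. T (i, j)) ?xs = map (\<lambda>i. T' (i, j)) ?xs"
    using strict_sorted_equal[OF sorted[OF T'] sorted[OF T]] by simp
  then show "T c = T' c"
    using c by (auto simp: cells_iff)
qed

text \<open>
  Let \<open>A m\<close> be the set of the \<open>m\<close> coordinates that carry \<open>\<kappa>\<^sub>1, \<dots>, \<kappa>\<^sub>m\<close>.  Its total is the largest that
  any tableau allows, so every column holds as many entries from \<open>A m\<close> as it can.  For \<open>m\<close> equal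
  to the length of a column this says that the column has exactly the entries \<open>A m\<close>.
\<close>

lemma extreme_content_unique:
  fixes T T' :: "nat \<times> nat \<Rightarrow> 'n::{finite,linorder}"
  assumes short: "\<And>j. j \<in> shape_columns lam \<Longrightarrow> col_len lam mu j \<le> CARD('n)"
    and e: "bij_betw e (UNIV :: 'n set) {1..CARD('n)}"
    and T: "T \<in> ssyt lam mu" "content lam mu T = kappa lam mu \<circ> e"
    and T': "T' \<in> ssyt lam mu" "content lam mu T' = kappa lam mu \<circ> e"
  shows "T = T'"
proof -
  define A where "A m = {i. e i \<le> m}" for m
  have eA: "bij_betw e (A m) {1..m}" if "m \<le> CARD('n)" for m
  proof (rule bij_betw_subset[OF e])
    show "A m \<subseteq> UNIV" by simp
    have "e ` UNIV = {1..CARD('n)}" using e by (simp add: bij_betw_def)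
    then show "e ` A m = {1..m}"
      using that unfolding A_def by (auto simp: image_iff set_eq_iff) (metis le_trans)
  qed
  have cA: "card (A m) = m" if "m \<le> CARD('n)" for m
    using bij_betw_same_card[OF eA[OF that]] by simp
  have forced: "column_entries lam mu S j = A (col_len lam mu j)"
    if S: "S \<in> ssyt lam mu" "content lam mu S = kappa lam mu \<circ> e" and j: "j \<in> shape_columns lam"
    for S :: "nat \<times> nat \<Rightarrow> 'n" and j
  proof -
    let ?E = "column_entries lam mu S"
    define m where "m = col_len lam mu j"
    have m: "m \<le> CARD('n)" using short j by (simp add: m_def)
    have "(\<Sum>l\<in>shape_columns lam. card (?E l \<inter> A m)) = sum (kappa lam mu \<circ> e) (A m)"
      using sum_content[OF S(1), of "A m"] S(2) by simp
    also have "\<dots> = (\<Sum>p=1..m. kappa lam mu p)"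
      using sum.reindex_bij_betw[OF eA[OF m], of "kappa lam mu"] by simp
    also have "\<dots> = (\<Sum>l\<in>shape_columns lam. min m (col_len lam mu l))"
      by (rule sum_kappa)
    finally have "(\<Sum>l\<in>shape_columns lam. card (?E l \<inter> A m)) =
        (\<Sum>l\<in>shape_columns lam. min m (col_len lam mu l))" .
    moreover have "card (?E l \<inter> A m) \<le> min m (col_len lam mu l)" for l
      using card_mono[of "A m" "?E l \<inter> A m"] card_mono[of "?E l" "?E l \<inter> A m"]
        card_column_entries[OF S(1), of l] cA[OF m] by simp
    ultimately have "card (?E j \<inter> A m) = min m (col_len lam mu j)"
      using sum_mono_inv[of "\<lambda>l. card (?E l \<inter> A m)" "shape_columns lam" "\<lambda>l. min m (col_len lam mu l)" j] j
      by (simp add: shape_columns_def)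
    then have c: "card (?E j \<inter> A m) = m" by (simp add: m_def)
    have "?E j \<inter> A m = ?E j"
      using c card_column_entries[OF S(1), of j] by (intro card_subset_eq) (auto simp: m_def)
    moreover have "?E j \<inter> A m = A m"
      using c cA[OF m] by (intro card_subset_eq) auto
    ultimately have "?E j = A m" by simp
    then show ?thesis by (simp add: m_def)
  qed
  show ?thesis
    using forced[OF T] forced[OF T'] by (intro ssyt_eqI T T') simp
qed

end

section \<open>Coefficients of skew Schur polynomials\<close>

lemma prod_monomials:
  "(\<Prod>c\<in>A. Poly_Mapping.single (f c) (1::int)) = Poly_Mapping.single (\<Sum>c\<in>A. f c) 1"
  by (induction A rule: infinite_finite_induct) (auto simp: mult_single)

lemma finite_ssyt:
  assumes "is_skew_shape lam mu"
  shows "finite (ssyt lam mu :: (nat \<times> nat \<Rightarrow> 'n::{finite,linorder}) set)"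
proof (rule finite_subset)
  show "ssyt lam mu \<subseteq> (cells lam mu \<rightarrow>\<^sub>E (UNIV :: 'n set))"
    by (auto simp: ssyt_def)
  show "finite (cells lam mu \<rightarrow>\<^sub>E (UNIV :: 'n set))"
    using finite_cells[OF assms] by (intro finite_PiE) auto
qed

lemma lookup_skew_schur:
  assumes "is_skew_shape lam mu"
  shows "Poly_Mapping.lookup (skew_schur lam mu) \<gamma> =
    int (card {T \<in> ssyt lam mu. content lam mu T = Poly_Mapping.lookup (\<gamma> :: 'n::{finite,linorder} \<Rightarrow>\<^sub>0 nat)})"
proof -
  have exponent: "\<gamma> = (\<Sum>c\<in>cells lam mu. Poly_Mapping.single (T c) 1) \<longleftrightarrow>
      content lam mu T = Poly_Mapping.lookup \<gamma>" for T :: "nat \<times> nat \<Rightarrow> 'n"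
  proof -
    have "Poly_Mapping.lookup (\<Sum>c\<in>cells lam mu. Poly_Mapping.single (T c) 1) v = content lam mu T v" for v
    proof -
      have "Poly_Mapping.lookup (\<Sum>c\<in>cells lam mu. Poly_Mapping.single (T c) 1) v =
          (\<Sum>c\<in>cells lam mu. if T c = v then 1 else 0)"
        by (simp add: lookup_sum lookup_single when_def)
      also have "\<dots> = content lam mu T v"
        using finite_cells[OF assms] by (simp add: sum.If_cases content_def Int_def)
      finally show ?thesis .
    qed
    then show ?thesis
      by (metis ext poly_mapping_eqI)
  qed
  have "Poly_Mapping.lookup (skew_schur lam mu) \<gamma> =
      (\<Sum>T\<in>ssyt lam mu.
        if \<gamma> = (\<Sum>c\<in>cells lam mu. Poly_Mapping.single (T c) 1) then 1 else 0)"
    by (simp add: skew_schur_def var_def prod_monomials lookup_sum lookup_single when_def)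
  also have "\<dots> = (\<Sum>T\<in>ssyt lam mu. if content lam mu T = Poly_Mapping.lookup \<gamma> then 1 else 0)"
    unfolding exponent ..
  finally show ?thesis
    using finite_ssyt[OF assms, where 'n = 'n] by (simp add: sum.If_cases Int_def)
qed

section \<open>Linear representability\<close>

text \<open>
  At most \<open>c\<close> points with distinct parameters on the moment curve \<open>x \<mapsto> (1, x, \<dots>, x\<^sup>c\<^sup>-\<^sup>1)\<close> are linearly
  independent: in a linear relation, subtracting \<open>t j\<close> times each equation from the next one
  removes the point \<open>j\<close> and multiplies the other coefficients by the nonzero \<open>t i - t j\<close>.
\<close>

lemma vandermonde_independent:
  fixes t a :: "'i \<Rightarrow> 'k::field"
  assumes "finite A" "inj_on t A" "card A \<le> c"
    and "\<And>p. p < c \<Longrightarrow> (\<Sum>i\<in>A. a i * t i ^ p) = 0" and "i \<in> A"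
  shows "a i = 0"
  using assms
proof (induction A arbitrary: a c i rule: finite_induct)
  case (insert j A)
  from insert.hyps insert.prems(2) obtain c' where c: "c = Suc c'"
    by (cases c) auto
  have shift: "(\<Sum>i\<in>A. (a i * (t i - t j)) * t i ^ p) = 0" if "p < c'" for p
  proof -
    have "(\<Sum>i\<in>insert j A. (a i * (t i - t j)) * t i ^ p) =
        (\<Sum>i\<in>insert j A. a i * t i ^ Suc p) - t j * (\<Sum>i\<in>insert j A. a i * t i ^ p)"
      unfolding sum_distrib_left sum_subtractf[symmetric]
      by (intro sum.cong) (auto simp: algebra_simps)
    also have "\<dots> = 0"
      using insert.prems(3)[of p] insert.prems(3)[of "Suc p"] that c by simp
    finally show ?thesis using insert.hyps by simp
  qed
  have zero: "a l = 0" if "l \<in> A" for l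
  proof -
    have "a l * (t l - t j) = 0"
      using insert.prems insert.hyps c shift that
      by (intro insert.IH[where c = c' and a = "\<lambda>i. a i * (t i - t j)"]) auto
    moreover have "t l \<noteq> t j"
      using insert.prems(1) insert.hyps that by (auto simp: inj_on_def)
    ultimately show ?thesis by simp
  qed
  have "a j + (\<Sum>i\<in>A. a i) = 0"
    using insert.prems(3)[of 0] insert.hyps c by simp
  moreover have "(\<Sum>i\<in>A. a i) = 0"
    using zero by (intro sum.neutral) auto
  ultimately have "a j = 0" by simp
  with zero insert.prems(4) show ?case by auto
qed simp

text \<open>For injectivity, a repetition \<open>f x = f y\<close> would give the nontrivial relation \<open>f x - f y = 0\<close>.\<close>

lemma coord_independent_family:
  fixes f :: "'i \<Rightarrow> nat \<Rightarrow>\<^sub>0 'k::field"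
  assumes "finite I"
    and ind: "\<And>u i. (\<Sum>x\<in>I. vscale (u x) (f x)) = 0 \<Longrightarrow> i \<in> I \<Longrightarrow> u i = 0"
  shows "inj_on f I" and "coord.independent (f ` I)"
proof -
  show inj: "inj_on f I"
  proof (rule inj_onI, rule ccontr)
    fix x y assume xy: "x \<in> I" "y \<in> I" "f x = f y" "x \<noteq> y"
    let ?u = "\<lambda>z. if z = x then 1 else if z = y then - 1 else (0 :: 'k)"
    have "(\<Sum>z\<in>I. vscale (?u z) (f z)) =
        (\<Sum>z\<in>I. (if z = x then f x else 0) + (if z = y then - f y else 0))"
      using xy by (intro sum.cong) auto
    also have "\<dots> = 0"
      using xy \<open>finite I\<close> by (simp add: sum.distrib)
    finally have "?u x = 0"
      using ind[of ?u x] xy(1) by blast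
    then show False by simp
  qed
  show "coord.independent (f ` I)"
  proof
    assume "coord.dependent (f ` I)"
    then obtain u v where uv: "v \<in> f ` I" "u v \<noteq> 0" "(\<Sum>v\<in>f ` I. vscale (u v) v) = 0"
      using \<open>finite I\<close> by (auto simp: coord.dependent_finite)
    from uv(3) have "(\<Sum>x\<in>I. vscale (u (f x)) (f x)) = 0"
      by (simp add: sum.reindex[OF inj])
    with ind[of "\<lambda>x. u (f x)"] uv(1,2) show False by auto
  qed
qed

text \<open>
  The space of all finitely supported sequences is infinite-dimensional, so the dimension of \<open>W\<close> is
  obtained by extending \<open>B\<close> to a basis of \<open>W\<close> and comparing with \<open>G\<close> by the exchange lemma.
\<close>

lemma coord_dim_eqI:
  assumes B: "B \<subseteq> W" "coord.independent B" and G: "W \<subseteq> coord.span G" "finite G" "card G \<le> card B"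
  shows "coord.dim W = card B"
proof -
  obtain B' where B': "B \<subseteq> B'" "B' \<subseteq> W" "coord.independent B'" "W \<subseteq> coord.span B'"
    using coord.maximal_independent_subset_extend[OF B] by blast
  have "finite B'" and "card B' \<le> card G"
    using coord.independent_span_bound[OF G(2) B'(3)] B'(2) G(1) by auto
  then have "B = B'"
    using B'(1) G(3) by (intro card_seteq) auto
  then show ?thesis
    using B' by (intro coord.dim_unique) auto
qed

text \<open>
  The point with parameter \<open>x\<close> on the moment curve of length \<open>c j\<close>, placed in the \<open>j\<close>-th block of
  coordinates; \<open>prod_encode (j, p)\<close> is the \<open>p\<close>-th coordinate of this block.
\<close>

definition moment_vector :: "(nat \<Rightarrow> nat) \<Rightarrow> 'k::field \<Rightarrow> nat \<Rightarrow> (nat \<Rightarrow>\<^sub>0 'k)" where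
  "moment_vector c x j = (\<Sum>p<c j. Poly_Mapping.single (prod_encode (j, p)) (x ^ p))"

lemma lookup_moment_vector:
  "Poly_Mapping.lookup (moment_vector c x j) (prod_encode (j', p)) =
     (if j = j' \<and> p < c j then x ^ p else 0)"
  by (auto simp: moment_vector_def lookup_sum lookup_single when_def sum.delta'
      intro!: sum.neutral)

text \<open>
  Each \<open>j\<close> contributes a uniform matroid of rank \<open>c j\<close>, represented by points of a moment curve with
  distinct parameters \<open>t i\<close>; the subspace \<open>V i\<close> is spanned by the points with parameter \<open>t i\<close> in all
  blocks.  For the dimension of the sum over \<open>A\<close>, the set \<open>B\<close> consists of \<open>min {|A|, c j}\<close> of the
  points in each block, and the spanning set \<open>G\<close> of all the points from \<open>A\<close> or, if there are
  more than \<open>c j\<close> of these, of the unit vectors of the block.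
\<close>

lemma sum_of_uniform_representable:
  fixes c :: "nat \<Rightarrow> nat"
  assumes "infinite (UNIV :: 'k::field set)"
  shows "linearly_representable TYPE('k) (\<lambda>A :: 'n::finite set. \<Sum>j<N. min (card A) (c j))"
proof -
  obtain K :: "'k set" where K: "finite K" "card K = CARD('n)"
    using infinite_arbitrarily_large[OF assms] by blast
  obtain t :: "'n \<Rightarrow> 'k" where t: "inj t"
    using finite_same_card_bij[OF finite K(1)] K(2) by (metis bij_betw_def)
  define w where "w i j = moment_vector c (t i) j" for i j
  define V where "V i = coord.span (w i ` {..<N})" for i
  define e :: "nat \<times> nat \<Rightarrow> (nat \<Rightarrow>\<^sub>0 'k)" where "e jp = Poly_Mapping.single (prod_encode jp) 1" for jp
  have w_e: "w i j = (\<Sum>p<c j. vscale (t i ^ p) (e (j, p)))" for i j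
    unfolding w_def moment_vector_def e_def
    by (intro sum.cong refl poly_mapping_eqI) (simp add: lookup_vscale lookup_single when_def)
  obtain m where m: "prod_encode ` (SIGMA j:{..<N}. {..<c j}) \<subseteq> {..<m}"
    using finite_nat_bounded[of "prod_encode ` (SIGMA j:{..<N}. {..<c j})"] by auto
  have sub: "coord.subspace (V i) \<and> V i \<subseteq> coord_space m" for i
  proof
    show "coord.subspace (V i)" unfolding V_def by (rule coord.subspace_span)
    have "coord.subspace (coord_space m :: (nat \<Rightarrow>\<^sub>0 'k) set)"
      by (auto simp: coord.subspace_def coord_space_def lookup_add lookup_vscale)
    moreover have "w i j \<in> coord_space m" if "j < N" for j
      unfolding coord_space_def mem_Collect_eq
    proof (intro allI impI)
      fix q assume "m \<le> q"
      obtain j' p where q: "q = prod_encode (j', p)"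
        by (metis prod_decode_inverse surj_pair)
      have "\<not> (j = j' \<and> p < c j)"
        using m that \<open>m \<le> q\<close> by (force simp: q image_subset_iff)
      then show "Poly_Mapping.lookup (w i j) q = 0"
        unfolding w_def q lookup_moment_vector by (rule if_not_P)
    qed
    ultimately show "V i \<subseteq> coord_space m"
      unfolding V_def by (intro coord.span_minimal) auto
  qed
  have "coord.dim {\<Sum>i\<in>A. v i | v. \<forall>i\<in>A. v i \<in> V i} = (\<Sum>j<N. min (card A) (c j))" for A
  proof -
    let ?W = "{\<Sum>i\<in>A. v i | v. \<forall>i\<in>A. v i \<in> V i}"
    have "\<exists>A'. A' \<subseteq> A \<and> card A' = min (card A) (c j)" for j
      by (metis min.cobounded1 obtain_subset_with_card_n)
    then obtain A' where A': "\<And>j. A' j \<subseteq> A" "\<And>j. card (A' j) = min (card A) (c j)"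
      by metis
    define I where "I = (SIGMA j:{..<N}. A' j)"
    define f where "f = (\<lambda>(j, i). w i j)"
    have "finite I" by (simp add: I_def)
    have ind: "u x = 0" if zero: "(\<Sum>y\<in>I. vscale (u y) (f y)) = 0" and "x \<in> I" for u x
    proof -
      obtain j i where x: "x = (j, i)" "j < N" "i \<in> A' j"
        using \<open>x \<in> I\<close> by (auto simp: I_def)
      have "u (j, i) = 0"
      proof (rule vandermonde_independent[where t = t and A = "A' j" and a = "\<lambda>i. u (j, i)" and c = "c j"])
        show "inj_on t (A' j)" using t by (rule inj_on_subset) simp
        fix p assume p: "p < c j"
        \<comment> \<open>The coordinate \<open>(j, p)\<close> only sees block \<open>j\<close>.\<close>
        have "0 = Poly_Mapping.lookup (\<Sum>y\<in>I. vscale (u y) (f y)) (prod_encode (j, p))"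
          using zero by simp
        also have "\<dots> = (\<Sum>(l, i)\<in>I. u (l, i) * (if l = j \<and> p < c l then t i ^ p else 0))"
          by (simp add: lookup_sum lookup_vscale f_def w_def lookup_moment_vector case_prod_unfold)
        also have "\<dots> = (\<Sum>l<N. \<Sum>i\<in>A' l. u (l, i) * (if l = j \<and> p < c l then t i ^ p else 0))"
          unfolding I_def by (subst sum.Sigma) auto
        also have "\<dots> = (\<Sum>l<N. if l = j then \<Sum>i\<in>A' j. u (j, i) * t i ^ p else 0)"
          using p by (intro sum.cong) auto
        also have "\<dots> = (\<Sum>i\<in>A' j. u (j, i) * t i ^ p)"
          using x by (simp add: sum.delta')
        finally show "(\<Sum>i\<in>A' j. u (j, i) * t i ^ p) = 0" by simp
      qed (use x A' in auto)
      then show ?thesis by (simp add: x)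
    qed
    have fI: "inj_on f I" "coord.independent (f ` I)"
      using coord_independent_family[of I f, OF \<open>finite I\<close>] ind by blast+
    have card_B: "card (f ` I) = (\<Sum>j<N. min (card A) (c j))"
      unfolding card_image[OF fI(1)] by (simp add: I_def A'(2))
    have "w i j \<in> ?W" if "i \<in> A" "j < N" for i j
    proof -
      have "w i j \<in> V i"
        unfolding V_def using that by (intro coord.span_base) auto
      then have "\<forall>l\<in>A. (if l = i then w i j else 0) \<in> V l"
        using sub coord.subspace_0 by (metis (full_types))
      moreover have "(\<Sum>l\<in>A. if l = i then w i j else 0) = w i j"
        using that by simp
      ultimately show ?thesis
        by (intro CollectI exI[of _ "\<lambda>l. if l = i then w i j else 0"]) simp
    qed
    then have B_W: "f ` I \<subseteq> ?W"
      using A'(1) by (fastforce simp: I_def f_def)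
    define G where "G j = (if card A \<le> c j then (\<lambda>i. w i j) ` A else (\<lambda>p. e (j, p)) ` {..<c j})" for j
    have card_G: "card (\<Union>j<N. G j) \<le> (\<Sum>j<N. min (card A) (c j))"
    proof (rule order_trans[OF card_UN_le])
      have "card (G j) \<le> min (card A) (c j)" for j
        using card_image_le[of A "\<lambda>i. w i j"] card_image_le[of "{..<c j}" "\<lambda>p. e (j, p)"]
        by (auto simp: G_def min_def)
      then show "(\<Sum>j<N. card (G j)) \<le> (\<Sum>j<N. min (card A) (c j))"
        by (intro sum_mono)
    qed simp
    have "w i j \<in> coord.span (G j)" if "i \<in> A" for i j
    proof (cases "card A \<le> c j")
      case True
      with that show ?thesis by (auto simp: G_def intro: coord.span_base)
    next
      case False
      then show ?thesis
        unfolding w_e by (intro coord.span_sum coord.span_scale coord.span_base) (auto simp: G_def)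
    qed
    then have "w i j \<in> coord.span (\<Union>j<N. G j)" if "i \<in> A" "j < N" for i j
      using that coord.span_mono[of "G j" "\<Union>j<N. G j"] by blast
    then have "V i \<subseteq> coord.span (\<Union>j<N. G j)" if "i \<in> A" for i
      unfolding V_def using that by (intro coord.span_minimal coord.subspace_span) auto
    then have W_G: "?W \<subseteq> coord.span (\<Union>j<N. G j)"
      by (auto intro!: coord.span_sum)
    have "finite (\<Union>j<N. G j)"
      by (simp add: G_def)
    then show ?thesis
      using coord_dim_eqI[OF B_W fI(2) W_G] card_G card_B by simp
  qed
  then show ?thesis
    unfolding linearly_representable_def using sub by blast
qed

section \<open>The support, the Newton polytope and the rank function\<close>

theorem theorem7p1:
  fixes lam mu :: "nat \<Rightarrow> nat"
    and s :: "('n::{finite,linorder} \<Rightarrow>\<^sub>0 nat) \<Rightarrow>\<^sub>0 int"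
  assumes "is_skew_shape lam mu"
  defines "s \<equiv> skew_schur lam mu"
  shows "(max_col_len lam mu > CARD('n) \<longrightarrow> s = 0) \<and>
    (max_col_len lam mu \<le> CARD('n) \<longrightarrow>
      exp_vec ` Supp s = permutohedron (kappa_vec lam mu) \<inter> integer_points \<and>
      Newt s = permutohedron (kappa_vec lam mu) \<and>
      (\<forall>A. support_rank s A = (\<Sum>j\<in>shape_columns lam. min (card A) (col_len lam mu j)) \<and>
           support_rank s A = (\<Sum>p=1..card A. kappa lam mu p)) \<and>
      (\<forall>\<gamma>. exp_vec \<gamma> extreme_point_of Newt s \<longrightarrow> Poly_Mapping.lookup s \<gamma> = 1) \<and>
      (infinite (UNIV :: 'k::field set) \<longrightarrow>
         linearly_representable TYPE('k) (support_rank s)))"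
proof (intro conjI impI)
  note shape = \<open>is_skew_shape lam mu\<close>
  assume "max_col_len lam mu > CARD('n)"
  moreover have "max_col_len lam mu \<in> insert 0 (col_len lam mu ` shape_columns lam)"
    unfolding max_col_len_def by (intro Max_in) (auto simp: shape_columns_def)
  ultimately obtain j where j: "col_len lam mu j > CARD('n)" by auto
  have "T \<notin> ssyt lam mu" for T :: "nat \<times> nat \<Rightarrow> 'n"
  proof
    assume "T \<in> ssyt lam mu"
    then have "card (column_entries lam mu T j) > CARD('n)"
      using j by (simp add: card_column_entries[OF shape])
    then show False
      using card_mono[of UNIV "column_entries lam mu T j"] by simp
  qed
  then have "(ssyt lam mu :: (nat \<times> nat \<Rightarrow> 'n) set) = {}" by blast
  then show "s = 0" by (simp add: s_def skew_schur_def)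
next
  note shape = \<open>is_skew_shape lam mu\<close>
  assume max: "max_col_len lam mu \<le> CARD('n)"
  have short: "col_len lam mu j \<le> CARD('n)" if "j \<in> shape_columns lam" for j
  proof -
    have "col_len lam mu j \<le> max_col_len lam mu"
      unfolding max_col_len_def using that by (intro Max_ge) (auto simp: shape_columns_def)
    with max show ?thesis by simp
  qed
  let ?k = "kappa lam mu"
  note k = kappa_antimono
  have dom_content: "dominated ?k \<alpha> \<longleftrightarrow> (\<exists>T\<in>ssyt lam mu. content lam mu T = \<alpha>)" for \<alpha> :: "'n \<Rightarrow> nat"
  proof -
    have "content lam mu ` ssyt lam mu = {\<alpha> :: 'n \<Rightarrow> nat. dominated ?k \<alpha>}"
      using short by (rule contents_eq_dominated[OF shape])
    then have "dominated ?k \<alpha> \<longleftrightarrow> \<alpha> \<in> content lam mu ` ssyt lam mu" by simp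
    then show ?thesis by (auto simp: image_iff)
  qed
  have Supp: "\<gamma> \<in> Supp s \<longleftrightarrow> dominated ?k (Poly_Mapping.lookup \<gamma>)" for \<gamma>
    using finite_ssyt[OF shape, where 'n = 'n]
    by (auto simp: Supp_def s_def lookup_skew_schur[OF shape] dom_content)
  have Supp_image: "g ` Poly_Mapping.lookup ` Supp s = g ` {\<alpha>. dominated ?k \<alpha>}" for g :: "('n \<Rightarrow> nat) \<Rightarrow> 'b"
  proof -
    have "\<alpha> \<in> Poly_Mapping.lookup ` Supp s" if "dominated ?k \<alpha>" for \<alpha>
    proof
      show "\<alpha> = Poly_Mapping.lookup (Abs_poly_mapping \<alpha>)" by simp
      with that show "Abs_poly_mapping \<alpha> \<in> Supp s" by (simp add: Supp)
    qed
    then have "Poly_Mapping.lookup ` Supp s = {\<alpha>. dominated ?k \<alpha>}"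
      by (auto simp: Supp)
    then show ?thesis by simp
  qed
  have exp_vec: "exp_vec \<gamma> = real_vec (Poly_Mapping.lookup \<gamma>)" for \<gamma> :: "'n \<Rightarrow>\<^sub>0 nat"
    by (simp add: exp_vec_def real_vec_def)
  have exp_Supp: "exp_vec ` Supp s = real_vec ` {\<alpha>. dominated ?k \<alpha>}"
    using Supp_image[of real_vec] by (simp add: exp_vec image_image)
  have kappa_vec: "kappa_vec lam mu = real_vec (\<lambda>i::'n. ?k (card {..i}))"
    by (simp add: kappa_vec_def real_vec_def)
  show "exp_vec ` Supp s = permutohedron (kappa_vec lam mu) \<inter> integer_points"
    unfolding exp_Supp kappa_vec permutohedron_integer_points[OF k] ..
  show Newt: "Newt s = permutohedron (kappa_vec lam mu)"
    unfolding Newt_def exp_Supp kappa_vec permutohedron_eq_hull_dominated[OF k] ..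
  have rank: "support_rank s A = sum ?k {1..card A}" for A
  proof -
    have "support_rank s A = Max ((\<lambda>\<alpha>. sum \<alpha> A) ` {\<alpha>. dominated ?k \<alpha>})"
      unfolding support_rank_def Supp_image[symmetric] by (simp add: image_image)
    also have "\<dots> = sum ?k {1..card A}"
    proof (rule Max_eqI)
      have "(\<lambda>\<alpha>. sum \<alpha> A) ` {\<alpha>. dominated ?k \<alpha>} \<subseteq> {..sum ?k {1..card A}}"
        by (auto simp: dominated_def)
      then show "finite ((\<lambda>\<alpha>. sum \<alpha> A) ` {\<alpha>. dominated ?k \<alpha>})"
        by (rule finite_subset) simp
      show "y \<le> sum ?k {1..card A}" if "y \<in> (\<lambda>\<alpha>. sum \<alpha> A) ` {\<alpha>. dominated ?k \<alpha>}" for y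
        using that by (auto simp: dominated_def)
      obtain e where e: "bij_betw e (UNIV :: 'n set) {1..CARD('n)}" "bij_betw e A {1..card A}"
        by (rule rearrangement_initial_on)
      have "sum ?k {1..card A} = sum (?k \<circ> e) A"
        using sum.reindex_bij_betw[OF e(2), of ?k] by simp
      then show "sum ?k {1..card A} \<in> (\<lambda>\<alpha>. sum \<alpha> A) ` {\<alpha>. dominated ?k \<alpha>}"
        using dominated_rearrangement[OF k e(1)] by (metis imageI mem_Collect_eq)
    qed
    finally show ?thesis .
  qed
  show "\<forall>A. support_rank s A = (\<Sum>j\<in>shape_columns lam. min (card A) (col_len lam mu j)) \<and>
      support_rank s A = (\<Sum>p=1..card A. kappa lam mu p)"
    unfolding rank sum_kappa by simp
  show "\<forall>\<gamma>. exp_vec \<gamma> extreme_point_of Newt s \<longrightarrow> Poly_Mapping.lookup s \<gamma> = 1"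
  proof (intro allI impI)
    fix \<gamma> assume "exp_vec \<gamma> extreme_point_of Newt s"
    then have "exp_vec \<gamma> \<in> {real_vec (?k \<circ> e) | e. bij_betw e (UNIV :: 'n set) {1..CARD('n)}}"
      unfolding Newt kappa_vec permutohedron_eq_hull_rearrangements
      by (rule extreme_point_of_convex_hull)
    then obtain e where e: "bij_betw e (UNIV :: 'n set) {1..CARD('n)}"
      and "real_vec (Poly_Mapping.lookup \<gamma>) = real_vec (?k \<circ> e)"
      by (auto simp: exp_vec)
    then have \<gamma>: "Poly_Mapping.lookup \<gamma> = ?k \<circ> e"
      by (simp add: vec_eq_iff fun_eq_iff)
    obtain T :: "nat \<times> nat \<Rightarrow> 'n" where T: "T \<in> ssyt lam mu" "content lam mu T = ?k \<circ> e"
      using dominated_rearrangement[OF k e] dom_content by blast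
    have "{T \<in> ssyt lam mu. content lam mu T = ?k \<circ> e} = {T}"
      using extreme_content_unique[OF shape short e] T by blast
    then show "Poly_Mapping.lookup s \<gamma> = 1"
      by (simp add: s_def lookup_skew_schur[OF shape] \<gamma>)
  qed
  show "linearly_representable TYPE('k) (support_rank s)" if "infinite (UNIV :: 'k set)"
  proof -
    have "support_rank s = (\<lambda>A. \<Sum>j<lam 0. min (card A) (col_len lam mu j))"
      unfolding fun_eq_iff rank sum_kappa shape_columns_def by simp
    then show ?thesis
      using sum_of_uniform_representable[OF that] by simp
  qed
qed

end
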